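(* If $P(Z_1>x)\sim x^{-\beta}L(x)$ as $x\to+\infty$ for some $1<\beta<2$, and $\gamma>\beta-1$, then for every $\epsilon>0$, $$\lim_{n\to\infty}m^{(\beta-1)n}L(m^n)^{-1}P\left(\frac{Z_{n+1}}{Z_n}-m\ge\epsilon\right)=I_\beta\,\epsilon^{-\beta}.$$
   Context: $(Z_n)_{n\ge0}$ is a Galton-Watson process with $Z_0=1$ and offspring distribution $\{p_k\}_{k\ge0}$ such that $p_0=0$, $0<p_1<1$, with finite mean $m=\sum_{k\ge1}kp_k>1$ and $E[Z_1\log Z_1]<\infty$. Then $W=\lim_{n\to\infty}Z_n/m^n$ exists almost surely and has a continuous density $\omega$ on $(0,\infty)$. The Schröder constant $\gamma>0$ is defined by $p_1=m^{-\gamma}$. For $0\le t<\gamma+1$, $I_t=\int_0^\infty u^{1-t}\omega(u)\,du$ (finite). $L$ is a (positive) slowly varying function. Standing assumption on the norming function: let $X_1,X_2,\dots$ be i.i.d. copies of $Z_1-m$ and $S_k=X_1+\cdots+X_k$. Then $X_1$ is in the domain of attraction of a $\beta$-stable law: $b(k)^{-1}S_k$ converges in distribution to a strictly $\beta$-stable random variable, where $b:[0,\infty)\to[0,\infty)$ is continuous, increasing and onto, $b(0)=0$, $b(x)=x^{1/\beta}s(x)$ for $x>0$ with $s$ slowly varying. It is assumed that $\liminf_{x\to+\infty}s(x)\in(0,+\infty]$. *)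

theory Defs
  imports "HOL-Probability.Probability"
begin

text \<open>The variable \<open>\<xi> n i\<close> is the number of children of the \<open>i\<close>-th individual of
  generation \<open>n\<close>.\<close>

definition galton_watson :: "'a measure \<Rightarrow> nat pmf \<Rightarrow> (nat \<Rightarrow> 'a \<Rightarrow> nat) \<Rightarrow> bool" where
  "galton_watson M p Z \<longleftrightarrow> prob_space M \<and>
    (\<exists>\<xi> :: nat \<Rightarrow> nat \<Rightarrow> 'a \<Rightarrow> nat.
       prob_space.indep_vars M (\<lambda>_. count_space UNIV) (\<lambda>(n, i). \<xi> n i) UNIV \<and>
       (\<forall>n i. distr M (count_space UNIV) (\<xi> n i) = measure_pmf p) \<and>
       (\<forall>x\<in>space M. Z 0 x = 1 \<and> (\<forall>n. Z (Suc n) x = (\<Sum>i<Z n x. \<xi> n i x))))"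

text \<open>Slow variation at infinity in the sense of Karamata; only the behaviour on a
  neighbourhood of infinity matters.\<close>

definition slowly_varying :: "(real \<Rightarrow> real) \<Rightarrow> bool" where
  "slowly_varying l \<longleftrightarrow>
    (\<exists>x0. set_borel_measurable borel {x0..} l \<and> (\<forall>x\<ge>x0. 0 < l x)) \<and>
    (\<forall>c>0. ((\<lambda>x. l (c * x) / l x) \<longlongrightarrow> 1) at_top)"

text \<open>For independent \<open>Y\<^sub>1\<close>, \<open>Y\<^sub>2\<close> with law \<open>\<mu>\<close>, the sum \<open>a Y\<^sub>1 + c Y\<^sub>2\<close> has, without
  centring, the law of \<open>r Y\<^sub>1\<close>, where \<open>r\<close> is the \<open>\<beta>\<close>-th root of \<open>a\<^sup>\<beta> + c\<^sup>\<beta>\<close>.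
  Point masses are excluded.\<close>

definition strictly_stable :: "real \<Rightarrow> real measure \<Rightarrow> bool" where
  "strictly_stable \<beta> \<mu> \<longleftrightarrow> real_distribution \<mu> \<and> (\<forall>c. \<mu> \<noteq> return borel c) \<and>
    (\<forall>a>0. \<forall>c>0. distr (\<mu> \<Otimes>\<^sub>M \<mu>) borel (\<lambda>(x, y). a * x + c * y) =
       distr \<mu> borel (\<lambda>x. (a powr \<beta> + c powr \<beta>) powr (1 / \<beta>) * x))"

definition iid_copies :: "'b measure \<Rightarrow> (nat \<Rightarrow> 'b \<Rightarrow> real) \<Rightarrow> real measure \<Rightarrow> bool" where
  "iid_copies N X \<nu> \<longleftrightarrow> prob_space N \<and>
    prob_space.indep_vars N (\<lambda>_. borel) X UNIV \<and> (\<forall>i. distr N borel (X i) = \<nu>)"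

definition norming_function :: "real \<Rightarrow> (real \<Rightarrow> real) \<Rightarrow> (real \<Rightarrow> real) \<Rightarrow> bool" where
  "norming_function \<beta> b s \<longleftrightarrow>
    continuous_on {0..} b \<and> mono_on {0..} b \<and> b ` {0..} = {0..} \<and> b 0 = 0 \<and>
    (\<forall>x>0. b x = x powr (1 / \<beta>) * s x) \<and> slowly_varying s \<and>
    0 < Liminf at_top (\<lambda>x. ereal (s x))"

definition continuous_density_on_pos ::
    "'a measure \<Rightarrow> ('a \<Rightarrow> real) \<Rightarrow> (real \<Rightarrow> real) \<Rightarrow> bool" where
  "continuous_density_on_pos M W w \<longleftrightarrow>
    continuous_on {0<..} w \<and> (\<forall>u>0. 0 \<le> w u) \<and>
    distributed M lborel W (\<lambda>u. ennreal (indicator {0<..} u * w u))"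

text \<open>This is \<open>I\<^sub>t\<close>, a Lebesgue integral. For \<open>w\<close> the density of the Galton-Watson limit
  it is finite when \<open>t < \<gamma> + 1\<close>; if the integral diverged, its value here would be 0.\<close>

definition moment_I :: "(real \<Rightarrow> real) \<Rightarrow> real \<Rightarrow> real" where
  "moment_I w t = (LBINT u:{0<..}. u powr (1 - t) * w u)"

end

theory Submission
  imports Defs "HOL-Real_Asymp.Real_Asymp"
begin

text \<open>Conditioning on \<open>Z\<^sub>n\<close>, the event is that a sum of \<open>Z\<^sub>n\<close> independent offspring numbers exceeds
  its mean by \<open>\<epsilon> Z\<^sub>n\<close>. With \<open>T x = P(Z\<^sub>1 > x)\<close>, a single big jump makes this happen with probability
  \<open>\<phi>(k) \<sim> \<epsilon>\<^sup>-\<^sup>\<beta> k T(k)\<close> given \<open>Z\<^sub>n = k\<close>. As \<open>V\<^sub>n = Z\<^sub>n / m\<^sup>n \<rightarrow> W\<close>, regular variation of \<open>T\<close> turns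
  \<open>\<phi>(Z\<^sub>n) / (m\<^sup>n T(m\<^sup>n))\<close> into \<open>\<epsilon>\<^sup>-\<^sup>\<beta> W\<^sup>1\<^sup>-\<^sup>\<beta>\<close> in the limit, and Potter's bounds dominate it by
  \<open>1 + V\<^sub>n\<^sup>-\<^sup>h\<close> with \<open>\<beta> - 1 < h < \<gamma>\<close>. Uniform integrability then follows from
  \<open>sup\<^sub>n E V\<^sub>n\<^sup>-\<^sup>a < \<infinity>\<close> for \<open>a < \<gamma>\<close>: the law of \<open>Z\<^sub>n\<^sub>+\<^sub>1\<close> is a mixture of sums of independent copies of \<open>Z\<^sub>n\<close>,
  so once \<open>P(Z\<^sub>n \<le> y) \<le> \<eta>\<close>, each further generation multiplies this probability by at most
  \<open>p\<^sub>1 + \<eta>\<close>, which is close to \<open>m\<^sup>-\<^sup>\<gamma>\<close>; and \<open>W > 0\<close> supplies the starting \<open>\<eta>\<close>.\<close>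

section \<open>Regularly varying tails\<close>

text \<open>Two obstacles shape the proof. First, \<beta> < 2 makes the offspring variance infinite.
  The upper bound therefore truncates at a small multiple of the number k of summands and lets a
  moment of order r < \<beta> stand in for the variance; the lower bound truncates at a fixed level
  and uses Hoeffding's inequality. Both concentration errors are o(1/k), whereas Potter's bound with
  exponent 2 > \<beta> keeps k T(k) above a constant multiple of 1/k, so that only the single jump
  survives. The gap between \<beta> - 1 and \<gamma> leaves room both for h and for a q > 1 with q h
  < \<gamma>. The conditioning splits the family tree before its last generation, while the negative
  moments need it split after the first. The two recursions agree because iterates of the offspring
  generating function f commute with f.\<close>

definition regularly_varying_tail :: "real \<Rightarrow> (real \<Rightarrow> real) \<Rightarrow> bool" where
  "regularly_varying_tail \<beta> T \<longleftrightarrow> antimono T \<and> (\<forall>x. 0 < T x) \<and> (\<forall>x. T x \<le> 1) \<and>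
    (\<forall>c>0. ((\<lambda>x. T (c * x) / T x) \<longlongrightarrow> c powr (- \<beta>)) at_top)"

lemma regularly_varying_tailD:
  assumes "regularly_varying_tail \<beta> T"
  shows "antimono T" "0 < T x" "T x \<le> 1"
    "0 < c \<Longrightarrow> ((\<lambda>x. T (c * x) / T x) \<longlongrightarrow> c powr (- \<beta>)) at_top"
  using assms unfolding regularly_varying_tail_def by auto

text \<open>Monotonicity of \<open>T\<close> replaces Karamata's uniform convergence theorem.\<close>

lemma regularly_varying_tail_tendsto:
  fixes c x :: "'i \<Rightarrow> real"
  assumes T: "regularly_varying_tail \<beta> T"
    and x: "filterlim x at_top F" and c: "(c \<longlongrightarrow> c0) F" and c0: "0 < c0"
  shows "((\<lambda>n. T (c n * x n) / T (x n)) \<longlongrightarrow> c0 powr (- \<beta>)) F"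
proof (rule order_tendstoI)
  note T_anti = regularly_varying_tailD(1)[OF T] and T_pos = regularly_varying_tailD(2)[OF T]
  have cont: "((\<lambda>d. d powr (- \<beta>)) \<longlongrightarrow> c0 powr (- \<beta>)) (nhds c0)"
    using c0 by (intro tendsto_powr filterlim_ident tendsto_const) auto
  have lim: "((\<lambda>n. T (d * x n) / T (x n)) \<longlongrightarrow> d powr (- \<beta>)) F" if "0 < d" for d
    using filterlim_compose[OF regularly_varying_tailD(4)[OF T that] x] .
  have xpos: "eventually (\<lambda>n. 0 < x n) F"
    using x by (simp add: filterlim_at_top_dense)
  fix a
  {
    assume a: "a < c0 powr (- \<beta>)"
    have "eventually (\<lambda>d. a < d powr (- \<beta>)) (at_right c0)"
      using order_tendstoD(1)[OF cont a] filter_leD[OF at_within_le_nhds] by blast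
    moreover have "eventually (\<lambda>d. c0 < d) (at_right c0)"
      by (rule eventually_at_right_less)
    ultimately have "eventually (\<lambda>d. a < d powr (- \<beta>) \<and> c0 < d) (at_right c0)"
      by eventually_elim auto
    \<comment> \<open>The varying factor \<open>c n\<close> is replaced by a constant
      \<open>d\<close> beyond \<open>c0\<close>, so close that the limit at \<open>d\<close> still
      exceeds \<open>a\<close>. Eventually \<open>c n < d\<close>, and monotonicity of
      \<open>T\<close> compares the two ratios. The other half uses \<open>d\<close> below
      \<open>c0\<close>.\<close>
    then obtain d where d: "a < d powr (- \<beta>)" "c0 < d"
      using eventually_happens'[OF trivial_limit_at_right_real] by blast
    have "eventually (\<lambda>n. a < T (d * x n) / T (x n)) F"
      using order_tendstoD(1)[OF lim d(1)] c0 d by auto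
    moreover have "eventually (\<lambda>n. c n < d) F"
      using order_tendstoD(2)[OF c d(2)] .
    ultimately show "eventually (\<lambda>n. a < T (c n * x n) / T (x n)) F" using xpos
    proof eventually_elim
      case (elim n)
      have "T (d * x n) \<le> T (c n * x n)"
        using elim by (intro antimonoD[OF T_anti] mult_right_mono) auto
      then have "T (d * x n) / T (x n) \<le> T (c n * x n) / T (x n)"
        using T_pos less_imp_le by (intro divide_right_mono) blast+
      with elim show ?case by linarith
    qed
  next
    assume a: "c0 powr (- \<beta>) < a"
    have "eventually (\<lambda>d. d powr (- \<beta>) < a) (at_left c0)"
      using order_tendstoD(2)[OF cont a] filter_leD[OF at_within_le_nhds] by blast
    moreover have "eventually (\<lambda>d. d < c0) (at_left c0)"
      by (auto simp: eventually_at_filter)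
    moreover have "eventually (\<lambda>d. 0 < d) (at_left c0)"
      using eventually_at_left_real[OF c0] by (rule eventually_mono) auto
    ultimately have "eventually (\<lambda>d. d powr (- \<beta>) < a \<and> d < c0 \<and> 0 < d) (at_left c0)"
      by eventually_elim auto
    then obtain d where d: "d powr (- \<beta>) < a" "d < c0" "0 < d"
      using eventually_happens'[OF trivial_limit_at_left_real] by blast
    have "eventually (\<lambda>n. T (d * x n) / T (x n) < a) F"
      using order_tendstoD(2)[OF lim d(1)] d by auto
    moreover have "eventually (\<lambda>n. d < c n) F"
      using order_tendstoD(1)[OF c d(2)] .
    ultimately show "eventually (\<lambda>n. T (c n * x n) / T (x n) < a) F" using xpos
    proof eventually_elim
      case (elim n)
      have "T (c n * x n) \<le> T (d * x n)"
        using elim by (intro antimonoD[OF T_anti] mult_right_mono) auto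
      then have "T (c n * x n) / T (x n) \<le> T (d * x n) / T (x n)"
        using T_pos less_imp_le by (intro divide_right_mono) blast+
      with elim show ?case by linarith
    qed
  }
qed

section \<open>Potter's bounds for monotone regularly varying tails\<close>

lemma powr_minus_quotient: "(u / c) powr (- a) = c powr a * u powr (- a)" for a c u :: real
  unfolding powr_divide by (simp add: powr_minus[of c a] divide_inverse)

lemma dyadic_bracket:
  fixes x y :: real
  assumes "0 < x" "x \<le> y"
  obtains j :: nat where "2 ^ j * x \<le> y" "y < 2 ^ Suc j * x"
proof -
  define P where "P j \<longleftrightarrow> y < 2 ^ j * x" for j
  obtain k :: nat where "y / x < 2 ^ k"
    using real_arch_pow[of 2 "y / x"] by auto
  then have "P k" using assms by (simp add: P_def field_simps)
  then have L: "P (LEAST j. P j)" by (rule LeastI)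
  moreover have "\<not> P 0" using assms by (simp add: P_def)
  ultimately obtain j where j: "(LEAST j. P j) = Suc j"
    by (metis not0_implies_Suc)
  then have "\<not> P j" using not_less_Least[of j P] by auto
  with L j that[of j] show thesis by (auto simp: P_def)
qed

text \<open>Since 2 powr (-\<beta>) < 2 powr (-a), one doubling far out multiplies \<open>T\<close>
  by at most 2 powr (-a). Iterating over the doublings between x and y gives the power, and
  monotonicity of \<open>T\<close> covers the remainder. The range starts at 1 because the bounds
  are later applied at positive integers.\<close>

lemma potter_upper:
  assumes T: "regularly_varying_tail \<beta> T" and a: "0 \<le> a" "a < \<beta>"
  obtains C where "0 < C" "\<And>x y. 1 \<le> x \<Longrightarrow> x \<le> y \<Longrightarrow> T y \<le> C * (y / x) powr (- a) * T x"
proof -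
  note T_anti = antimonoD[OF regularly_varying_tailD(1)[OF T]]
    and T_pos = regularly_varying_tailD(2)[OF T] and T_le1 = regularly_varying_tailD(3)[OF T]
  have "((\<lambda>x. T (2 * x) / T x) \<longlongrightarrow> 2 powr (- \<beta>)) at_top"
    using regularly_varying_tailD(4)[OF T] by simp
  moreover have "2 powr (- \<beta>) < 2 powr (- a)" using a by simp
  ultimately have "eventually (\<lambda>x. T (2 * x) / T x < 2 powr (- a)) at_top"
    by (rule order_tendstoD)
  then obtain x0 where x0: "\<And>x. x \<ge> x0 \<Longrightarrow> T (2 * x) / T x < 2 powr (- a)"
    unfolding eventually_at_top_linorder by auto
  define x1 where "x1 = max x0 1"
  have step: "T (2 * x) \<le> 2 powr (- a) * T x" if "x \<ge> x1" for x
    using x0[of x] that T_pos[of x] by (simp add: x1_def field_simps)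
  have x1: "1 \<le> x1" by (simp add: x1_def)
  have iter: "T (2 ^ j * x) \<le> (2 ^ j) powr (- a) * T x" if "x \<ge> x1" for x and j :: nat
  proof (induction j)
    case (Suc j)
    have "x1 \<le> 2 ^ j * x"
      using that x1 mult_mono[of 1 "2 ^ j" x1 x] by auto
    then have "T (2 * (2 ^ j * x)) \<le> 2 powr (- a) * T (2 ^ j * x)" by (rule step)
    also have "\<dots> \<le> 2 powr (- a) * ((2 ^ j) powr (- a) * T x)"
      using Suc.IH by (intro mult_left_mono) auto
    also have "\<dots> = (2 ^ Suc j) powr (- a) * T x"
      by (simp add: powr_mult)
    finally show ?case by (simp add: mult.assoc)
  qed simp
  have main: "T y \<le> 2 powr a * (y / x) powr (- a) * T x" if xy: "x1 \<le> x" "x \<le> y" for x y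
  proof -
    have xpos: "0 < x" using xy x1 by simp
    obtain j :: nat where j: "2 ^ j * x \<le> y" "y < 2 ^ Suc j * x"
      using dyadic_bracket[OF xpos xy(2)] .
    have "T y \<le> T (2 ^ j * x)" by (rule T_anti[OF j(1)])
    also have "\<dots> \<le> (2 ^ j) powr (- a) * T x" by (rule iter[OF xy(1)])
    \<comment> \<open>By maximality of j, 2^j exceeds half of y/x; this rounding costs the factor 2
      powr a.\<close>
    also have "(2 ^ j) powr (- a) \<le> ((y / x) / 2) powr (- a)"
      using j(2) xpos xy a by (intro powr_mono2') (auto simp: field_simps)
    also have "\<dots> = 2 powr a * (y / x) powr (- a)"
      by (rule powr_minus_quotient)
    finally show ?thesis using T_pos[of x] by (simp only: mult_right_mono less_imp_le)
  qed
  \<comment> \<open>Besides the rounding factor, the constant pays for raising both arguments to at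
    least \<open>x1\<close>: this changes y/x by at most the factor \<open>x1\<close>, and
    \<open>T\<close> by at most 1 / \<open>T x1\<close> because \<open>T\<close> is bounded by
    1.\<close>
  define C where "C = 2 powr a * x1 powr a / T x1"
  show thesis
  proof (rule that[of C])
    show "0 < C" using T_pos[of x1] x1 by (simp add: C_def)
    fix x y :: real assume xy: "1 \<le> x" "x \<le> y"
    let ?x = "max x x1" and ?y = "max y x1"
    have "T y \<le> T ?y / T x1"
    proof (cases "y \<le> x1")
      case True
      then show ?thesis using T_le1[of y] T_pos[of x1] by (simp add: max_def)
    next
      case False
      have "T y * T x1 \<le> T y * 1"
        using T_le1[of x1] T_pos[of y] by (intro mult_left_mono) auto
      then show ?thesis using False T_pos[of x1] by (simp add: field_simps)
    qed
    also have "T ?y \<le> 2 powr a * (?y / ?x) powr (- a) * T ?x"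
      using xy by (intro main) auto
    also have "\<dots> \<le> 2 powr a * (x1 powr a * (y / x) powr (- a)) * T x"
    proof (intro mult_mono)
      have "?x \<le> x1 * x"
        using xy x1 mult_mono[of 1 x1 x x] mult_mono[of x1 x1 1 x] by auto
      then have "y / (x1 * x) \<le> ?y / ?x"
        using xy x1 by (intro frac_le) auto
      then have "(?y / ?x) powr (- a) \<le> (y / (x1 * x)) powr (- a)"
        using xy x1 a by (intro powr_mono2') (auto intro!: divide_pos_pos mult_pos_pos)
      also have "\<dots> = x1 powr a * (y / x) powr (- a)"
        using powr_minus_quotient[of "y / x" x1 a] by (simp add: mult.commute)
      finally show "(?y / ?x) powr (- a) \<le> x1 powr a * (y / x) powr (- a)" .
    qed (use T_anti T_pos in \<open>auto intro: less_imp_le\<close>)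
    finally show "T y \<le> C * (y / x) powr (- a) * T x"
      using T_pos[of x1] by (simp add: C_def field_simps)
  qed
qed

text \<open>The mirror image of \<open>potter_upper\<close>: as a > \<beta>, one doubling far out
  costs \<open>T\<close> at most the factor 2 powr (-a).\<close>

lemma potter_lower:
  assumes T: "regularly_varying_tail \<beta> T" and a: "0 \<le> a" "\<beta> < a"
  obtains C where "0 < C" "\<And>x y. 1 \<le> x \<Longrightarrow> x \<le> y \<Longrightarrow> T x \<le> C * (y / x) powr a * T y"
proof -
  note T_anti = antimonoD[OF regularly_varying_tailD(1)[OF T]]
    and T_pos = regularly_varying_tailD(2)[OF T] and T_le1 = regularly_varying_tailD(3)[OF T]
  have "((\<lambda>x. T (2 * x) / T x) \<longlongrightarrow> 2 powr (- \<beta>)) at_top"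
    using regularly_varying_tailD(4)[OF T] by simp
  moreover have "2 powr (- a) < 2 powr (- \<beta>)" using a by simp
  ultimately have "eventually (\<lambda>x. 2 powr (- a) < T (2 * x) / T x) at_top"
    by (rule order_tendstoD)
  then obtain x0 where x0: "\<And>x. x \<ge> x0 \<Longrightarrow> 2 powr (- a) < T (2 * x) / T x"
    unfolding eventually_at_top_linorder by auto
  define x1 where "x1 = max x0 1"
  have step: "T x \<le> 2 powr a * T (2 * x)" if "x \<ge> x1" for x
    using x0[of x] that T_pos[of x] by (simp add: x1_def powr_minus field_simps)
  have x1: "1 \<le> x1" by (simp add: x1_def)
  have iter: "T x \<le> (2 ^ j) powr a * T (2 ^ j * x)" if "x \<ge> x1" for x and j :: nat
  proof (induction j)
    case (Suc j)
    have "x1 \<le> 2 ^ j * x"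
      using that x1 mult_mono[of 1 "2 ^ j" x1 x] by auto
    then have "T (2 ^ j * x) \<le> 2 powr a * T (2 * (2 ^ j * x))" by (rule step)
    then have "(2 ^ j) powr a * T (2 ^ j * x) \<le> (2 ^ j) powr a * (2 powr a * T (2 * (2 ^ j * x)))"
      by (intro mult_left_mono) auto
    also have "\<dots> = (2 ^ Suc j) powr a * T (2 ^ Suc j * x)"
      by (simp add: powr_mult mult.assoc mult.left_commute)
    finally show ?case using Suc.IH by linarith
  qed simp
  have main: "T x \<le> 2 powr a * (y / x) powr a * T y" if xy: "x1 \<le> x" "x \<le> y" for x y
  proof -
    have xpos: "0 < x" using xy x1 by simp
    obtain j :: nat where j: "2 ^ j * x \<le> y" "y < 2 ^ Suc j * x"
      using dyadic_bracket[OF xpos xy(2)] .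
    \<comment> \<open>Rounding goes up this time: 2^(j+1) x lies beyond y, so \<open>T\<close> there
      is at most \<open>T y\<close>, and 2^(j+1) is at most 2 y/x.\<close>
    have "T x \<le> (2 ^ Suc j) powr a * T (2 ^ Suc j * x)" by (rule iter[OF xy(1)])
    also have "\<dots> \<le> (2 * (y / x)) powr a * T y"
      using j xpos a T_pos less_imp_le xy
      by (intro mult_mono powr_mono2 T_anti) (auto simp: field_simps)
    also have "(2 * (y / x)) powr a = 2 powr a * (y / x) powr a"
      by (rule powr_mult)
    finally show ?thesis .
  qed
  define C where "C = 2 powr a * x1 powr a / T x1"
  show thesis
  proof (rule that[of C])
    show "0 < C" using T_pos[of x1] x1 by (simp add: C_def)
    fix x y :: real assume xy: "1 \<le> x" "x \<le> y"
    let ?x = "max x x1" and ?y = "max y x1"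
    have "T x \<le> T ?x / T x1"
    proof (cases "x \<le> x1")
      case True
      then show ?thesis using T_le1[of x] T_pos[of x1] by (simp add: max_def)
    next
      case False
      have "T x * T x1 \<le> T x * 1"
        using T_le1[of x1] T_pos[of x] by (intro mult_left_mono) auto
      then show ?thesis using False T_pos[of x1] by (simp add: field_simps)
    qed
    also have "T ?x \<le> 2 powr a * (?y / ?x) powr a * T ?y"
      using xy by (intro main) auto
    also have "\<dots> \<le> 2 powr a * (x1 powr a * (y / x) powr a) * T y"
    proof (intro mult_mono)
      have "?y \<le> x1 * y"
        using xy x1 mult_mono[of 1 x1 y y] mult_mono[of x1 x1 1 y] by auto
      then have "?y / ?x \<le> x1 * y / x"
        using xy x1 by (intro frac_le) auto
      then have "(?y / ?x) powr a \<le> (x1 * y / x) powr a"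
        using xy x1 a by (intro powr_mono2) auto
      also have "\<dots> = x1 powr a * (y / x) powr a"
        using xy x1 by (simp add: powr_mult powr_divide)
      finally show "(?y / ?x) powr a \<le> x1 powr a * (y / x) powr a" .
    qed (use T_anti T_pos in \<open>auto intro: less_imp_le\<close>)
    finally show "T x \<le> C * (y / x) powr a * T y"
      using T_pos[of x1] by (simp add: C_def field_simps)
  qed
qed

section \<open>Moments and uniform integrability\<close>

text \<open>A layer-cake bound over the levels c m^k: climbing one level raises
  \<open>V powr a\<close> by the factor m powr a, while the tail shrinks by \<rho>, so the layers
  form a convergent geometric series. It serves twice, for positive moments of the offspring law
  (ratio 2) and for negative moments of generation sizes (ratio m).\<close>

lemma nn_integral_powr_le_geometric:
  fixes V :: "'a \<Rightarrow> real" and a c m \<rho> C :: real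
  assumes "prob_space M" and V[measurable]: "V \<in> borel_measurable M"
    and nonneg: "\<And>x. x \<in> space M \<Longrightarrow> 0 \<le> V x"
    and c: "0 < c" and m: "1 < m" and a: "0 \<le> a" and C: "0 \<le> C"
    and \<rho>: "0 \<le> \<rho>" "m powr a * \<rho> < 1"
    and tail: "\<And>k. emeasure M {x \<in> space M. c * m ^ k < V x} \<le> ennreal (C * \<rho> ^ k)"
  shows "(\<integral>\<^sup>+x. ennreal (V x powr a) \<partial>M)
    \<le> ennreal (c powr a * (1 + m powr a * C / (1 - m powr a * \<rho>)))"
proof -
  interpret prob_space M by fact
  let ?g = "\<lambda>k x. ennreal ((m ^ Suc k) powr a) * indicator {x \<in> space M. c * m ^ k < V x} x"
  have pointwise: "ennreal (V x powr a) \<le> ennreal (c powr a) * (1 + (\<Sum>k. ?g k x))"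
    if x: "x \<in> space M" for x
  proof (cases "V x \<le> c")
    case True
    have "ennreal (V x powr a) \<le> ennreal (c powr a) * 1"
      using True nonneg[OF x] a by (auto intro!: ennreal_leI powr_mono2)
    also have "\<dots> \<le> ennreal (c powr a) * (1 + (\<Sum>k. ?g k x))"
      by (intro mult_left_mono) auto
    finally show ?thesis .
  next
    case False
    define P where "P j \<longleftrightarrow> V x \<le> c * m ^ j" for j
    obtain k where "V x / c < m ^ k"
      using real_arch_pow[OF m] by auto
    then have "P k" using c by (simp add: P_def field_simps)
    then have L: "P (LEAST j. P j)" by (rule LeastI)
    moreover have "\<not> P 0" using False by (simp add: P_def)
    ultimately obtain j where j: "(LEAST j. P j) = Suc j"
      by (metis not0_implies_Suc)
    \<comment> \<open>Now j is the last level below V, so the j-th term of the series alone already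
      bounds \<open>V x powr a\<close>.\<close>
    then have nP: "\<not> P j" using not_less_Least[of j P] by auto
    have "V x powr a \<le> (c * m ^ Suc j) powr a"
      using L[unfolded j, unfolded P_def] nonneg[OF x] a by (intro powr_mono2) auto
    also have "\<dots> = c powr a * (m ^ Suc j) powr a" by (rule powr_mult)
    finally have "ennreal (V x powr a) \<le> ennreal (c powr a) * ennreal ((m ^ Suc j) powr a)"
      by (simp add: ennreal_mult'[symmetric] ennreal_leI)
    also have "ennreal ((m ^ Suc j) powr a) = ?g j x"
      using nP x by (simp add: P_def not_le)
    also have "?g j x \<le> (\<Sum>k. ?g k x)"
      using sum_le_suminf[OF summableI, of "{j}" "\<lambda>k. ?g k x"]
      by (simp only: sum.insert sum.empty finite.intros empty_iff not_False_eq_True add_0_right zero_le simp_thms)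
    also have "\<dots> \<le> 1 + (\<Sum>k. ?g k x)" by simp
    finally show ?thesis by (simp add: mult_left_mono)
  qed
  have pow: "(m ^ k) powr a = (m powr a) ^ k" for k
    using m by (induction k) (simp_all add: powr_mult)
  have [measurable]: "{x \<in> space M. c * m ^ k < V x} \<in> sets M" for k by measurable
  have "(\<integral>\<^sup>+x. ennreal (V x powr a) \<partial>M) \<le> (\<integral>\<^sup>+x. ennreal (c powr a) * (1 + (\<Sum>k. ?g k x)) \<partial>M)"
    by (intro nn_integral_mono pointwise)
  also have "\<dots> = ennreal (c powr a) *
      (1 + (\<Sum>k. ennreal ((m ^ Suc k) powr a) * emeasure M {x \<in> space M. c * m ^ k < V x}))"
    by (simp add: nn_integral_cmult nn_integral_add nn_integral_suminf emeasure_space_1)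
  also have "\<dots> \<le> ennreal (c powr a) *
      (1 + (\<Sum>k. ennreal (m powr a * C * (m powr a * \<rho>) ^ k)))"
  proof (intro mult_left_mono add_left_mono suminf_le summableI)
    fix k
    have "ennreal ((m ^ Suc k) powr a) * emeasure M {x \<in> space M. c * m ^ k < V x}
        \<le> ennreal ((m ^ Suc k) powr a) * ennreal (C * \<rho> ^ k)"
      by (intro mult_left_mono tail) auto
    also have "\<dots> = ennreal ((m ^ Suc k) powr a * (C * \<rho> ^ k))"
      using C \<rho> by (simp add: ennreal_mult)
    also have "(m ^ Suc k) powr a * (C * \<rho> ^ k) = m powr a * C * (m powr a * \<rho>) ^ k"
      using pow[of "Suc k"] by (simp add: power_mult_distrib)
    finally show "ennreal ((m ^ Suc k) powr a) * emeasure M {x \<in> space M. c * m ^ k < V x}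
        \<le> ennreal (m powr a * C * (m powr a * \<rho>) ^ k)" .
  qed auto
  also have "(\<Sum>k. ennreal (m powr a * C * (m powr a * \<rho>) ^ k))
      = ennreal (m powr a * C / (1 - m powr a * \<rho>))"
  proof (rule suminf_ennreal_eq)
    have "(\<lambda>k. (m powr a * \<rho>) ^ k) sums (1 / (1 - m powr a * \<rho>))"
      using \<rho> by (intro geometric_sums) auto
    from sums_mult[OF this, of "m powr a * C"]
    show "(\<lambda>k. m powr a * C * (m powr a * \<rho>) ^ k) sums (m powr a * C / (1 - m powr a * \<rho>))"
      by simp
  qed (use C \<rho> in auto)
  also have "ennreal (c powr a) * (1 + ennreal (m powr a * C / (1 - m powr a * \<rho>)))
      = ennreal (c powr a * (1 + m powr a * C / (1 - m powr a * \<rho>)))"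
    using C \<rho> by (simp add: ennreal_mult ennreal_plus)
  finally show ?thesis .
qed

text \<open>A bound in \<open>L\<^sup>q\<close> for some \<open>q > 1\<close> gives uniform integrability:
  truncating at \<open>R\<close> costs at most \<open>K R\<^sup>1\<^sup>-\<^sup>q\<close>.\<close>

lemma expectation_tendsto_of_bounded_moment:
  fixes f :: "nat \<Rightarrow> 'a \<Rightarrow> real"
  assumes "prob_space M" and f[measurable]: "\<And>n. f n \<in> borel_measurable M" "g \<in> borel_measurable M"
    and nonneg: "\<And>n x. x \<in> space M \<Longrightarrow> 0 \<le> f n x"
    and lim: "AE x in M. (\<lambda>n. f n x) \<longlonglongrightarrow> g x"
    and q: "1 < q" and K: "0 \<le> K"
    and moment: "\<And>n. (\<integral>\<^sup>+x. ennreal (f n x powr q) \<partial>M) \<le> ennreal K"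
  shows "(\<lambda>n. \<integral>x. f n x \<partial>M) \<longlonglongrightarrow> (\<integral>x. g x \<partial>M)"
proof -
  interpret prob_space M by fact
  have g_nonneg: "AE x in M. 0 \<le> g x"
    using lim AE_space by eventually_elim (use nonneg in \<open>auto intro: LIMSEQ_le_const\<close>)
  \<comment> \<open>Fatou's lemma hands the moment bound on to the limit, so that \<open>g\<close>
    can be truncated with the same error as every \<open>f n\<close>.\<close>
  have "(\<integral>\<^sup>+x. ennreal (g x powr q) \<partial>M) \<le> (\<integral>\<^sup>+x. liminf (\<lambda>n. ennreal (f n x powr q)) \<partial>M)"
  proof (intro nn_integral_mono_AE)
    show "AE x in M. ennreal (g x powr q) \<le> liminf (\<lambda>n. ennreal (f n x powr q))"
      using lim g_nonneg AE_space
    proof eventually_elim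
      case (elim x)
      have "(\<lambda>n. ennreal (f n x powr q)) \<longlonglongrightarrow> ennreal (g x powr q)"
        using elim q nonneg by (intro tendsto_ennrealI tendsto_powr2 tendsto_const) auto
      then show ?case
        by (intro eq_refl lim_imp_Liminf[symmetric]) auto
    qed
  qed
  also have "\<dots> \<le> liminf (\<lambda>n. \<integral>\<^sup>+x. ennreal (f n x powr q) \<partial>M)"
    by (intro nn_integral_liminf) auto
  also have "\<dots> \<le> ennreal K"
    using Liminf_mono[of "\<lambda>n. \<integral>\<^sup>+x. ennreal (f n x powr q) \<partial>M" "\<lambda>_. ennreal K" sequentially] moment
    by (simp add: Liminf_const)
  finally have g_moment: "(\<integral>\<^sup>+x. ennreal (g x powr q) \<partial>M) \<le> ennreal K" .
  have trunc: "integrable M h \<and> \<bar>(\<integral>x. h x \<partial>M) - (\<integral>x. min (h x) R \<partial>M)\<bar> \<le> K * R powr (1 - q)"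
    if h[measurable]: "h \<in> borel_measurable M" and h0: "AE x in M. 0 \<le> h x" and R: "0 < R"
      and mom: "(\<integral>\<^sup>+x. ennreal (h x powr q) \<partial>M) \<le> ennreal K" for h :: "'a \<Rightarrow> real" and R
  proof
    have intq: "integrable M (\<lambda>x. h x powr q)"
      using le_less_trans[OF mom ennreal_less_top] by (intro integrableI_bounded) auto
    have bound: "(\<integral>x. h x powr q \<partial>M) \<le> K"
      using mom K by (simp add: integral_eq_nn_integral enn2real_leI)
    \<comment> \<open>Above R, write h as h^q times h^(1-q); the second factor is at most R^(1-q)
      because q > 1.\<close>
    have pw: "h x - min (h x) R \<le> h x powr q * R powr (1 - q)" if "0 \<le> h x" for x
    proof (cases "h x \<le> R")
      case False
      then have "h x powr (1 - q) \<le> R powr (1 - q)"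
        using R q by (intro powr_mono2') auto
      then have "h x powr q * h x powr (1 - q) \<le> h x powr q * R powr (1 - q)"
        by (intro mult_left_mono) auto
      moreover have "h x powr q * h x powr (1 - q) = h x"
        using False R by (simp add: powr_add[symmetric])
      ultimately show ?thesis using False R by auto
    qed simp
    show int: "integrable M h"
    proof (rule Bochner_Integration.integrable_bound)
      show "integrable M (\<lambda>x. R + h x powr q * R powr (1 - q))" using intq by auto
      show "AE x in M. norm (h x) \<le> norm (R + h x powr q * R powr (1 - q))"
        using h0
      proof eventually_elim
        case (elim x)
        have "0 \<le> h x powr q * R powr (1 - q)" by simp
        then have "h x \<le> R + h x powr q * R powr (1 - q)"
          using pw[OF elim] by (cases "h x \<le> R") linarith+
        then show ?case using elim R by simp
      qed
    qed auto
    have int2: "integrable M (\<lambda>x. min (h x) R)" using int by auto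
    have "(\<integral>x. h x \<partial>M) - (\<integral>x. min (h x) R \<partial>M) = (\<integral>x. h x - min (h x) R \<partial>M)"
      using int int2 by simp
    moreover have "(\<integral>x. h x - min (h x) R \<partial>M) \<le> (\<integral>x. h x powr q * R powr (1 - q) \<partial>M)"
      using int int2 intq pw h0 by (intro integral_mono_AE) auto
    moreover have "(\<integral>x. h x powr q * R powr (1 - q) \<partial>M) \<le> K * R powr (1 - q)"
      using bound by (simp add: mult_right_mono)
    moreover have "0 \<le> (\<integral>x. h x - min (h x) R \<partial>M)"
      by (intro integral_nonneg_AE) auto
    ultimately show "\<bar>(\<integral>x. h x \<partial>M) - (\<integral>x. min (h x) R \<partial>M)\<bar> \<le> K * R powr (1 - q)" by linarith
  qed
  have trunc_lim: "(\<lambda>n. \<integral>x. min (f n x) R \<partial>M) \<longlonglongrightarrow> (\<integral>x. min (g x) R \<partial>M)" if "0 < R" for R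
  proof (rule integral_dominated_convergence[where w = "\<lambda>_. R"])
    show "AE x in M. (\<lambda>n. min (f n x) R) \<longlonglongrightarrow> min (g x) R"
      using lim by eventually_elim (intro tendsto_min tendsto_const)
    show "AE x in M. norm (min (f n x) R) \<le> R" for n
      using nonneg that by (intro AE_I2) (auto simp: abs_le_iff)
  qed auto
  show ?thesis
  proof (rule LIMSEQ_I)
    fix r :: real assume r: "0 < r"
    have "((\<lambda>R. K * R powr (1 - q)) \<longlongrightarrow> K * 0) at_top"
      using q by (intro tendsto_mult tendsto_const tendsto_neg_powr filterlim_ident) auto
    then have "eventually (\<lambda>R. K * R powr (1 - q) < r / 3) at_top"
      using r by (intro order_tendstoD) auto
    then have "eventually (\<lambda>R. K * R powr (1 - q) < r / 3 \<and> 0 < R) at_top"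
      using eventually_gt_at_top[of 0] by eventually_elim auto
    then obtain R where R: "K * R powr (1 - q) < r / 3" "0 < R"
      using eventually_happens'[OF trivial_limit_at_top_linorder] by blast
    obtain n0 where n0: "\<And>n. n \<ge> n0 \<Longrightarrow> \<bar>(\<integral>x. min (f n x) R \<partial>M) - (\<integral>x. min (g x) R \<partial>M)\<bar> < r / 3"
      using LIMSEQ_D[OF trunc_lim[OF R(2)], of "r / 3"] r by auto
    have "\<bar>(\<integral>x. f n x \<partial>M) - (\<integral>x. g x \<partial>M)\<bar> < r" if "n \<ge> n0" for n
    proof -
      have "\<bar>(\<integral>x. f n x \<partial>M) - (\<integral>x. min (f n x) R \<partial>M)\<bar> \<le> K * R powr (1 - q)"
        using trunc[of "f n" R] nonneg moment[of n] R(2) by auto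
      moreover have "\<bar>(\<integral>x. g x \<partial>M) - (\<integral>x. min (g x) R \<partial>M)\<bar> \<le> K * R powr (1 - q)"
        using trunc[of g R] g_nonneg g_moment R(2) by auto
      ultimately show ?thesis using n0[OF that] R(1) by linarith
    qed
    then show "\<exists>no. \<forall>n\<ge>no. norm ((\<integral>x. f n x \<partial>M) - (\<integral>x. g x \<partial>M)) < r" by auto
  qed
qed

section \<open>Truncated moments\<close>

definition pmf_tail :: "nat pmf \<Rightarrow> real \<Rightarrow> real" where
  "pmf_tail p x = measure_pmf.prob p {k. x < real k}"

text \<open>With a halfway between r and \<beta>, Potter's bound makes the tail at 2^k at most C
  2^(-ak), and the dyadic layers sum because r < a.\<close>

lemma pmf_tail_moment_bound:
  assumes T: "regularly_varying_tail \<beta> (pmf_tail p)" and r: "0 \<le> r" "r < \<beta>"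
  obtains K where "0 \<le> K" "(\<integral>\<^sup>+k. ennreal (real k powr r) \<partial>measure_pmf p) \<le> ennreal K"
proof -
  define a where "a = (r + \<beta>) / 2"
  have a: "0 \<le> a" "a < \<beta>" "r < a" using r by (auto simp: a_def)
  obtain C where C: "0 < C"
    "\<And>x y. 1 \<le> x \<Longrightarrow> x \<le> y \<Longrightarrow> pmf_tail p y \<le> C * (y / x) powr (- a) * pmf_tail p x"
    using potter_upper[OF T a(1,2)] by blast
  have "2 powr r * 2 powr (- a) = (2::real) powr (r - a)" by (simp add: powr_add[symmetric])
  also have "\<dots> < 1" using a by (simp add: powr_less_one)
  finally have ratio: "2 powr r * 2 powr (- a) < (1::real)" .
  have "(\<integral>\<^sup>+k. ennreal (real k powr r) \<partial>measure_pmf p)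
    \<le> ennreal (1 powr r * (1 + 2 powr r * C / (1 - 2 powr r * 2 powr (- a))))"
  proof (rule nn_integral_powr_le_geometric)
    fix k :: nat
    have "pmf_tail p (2 ^ k) \<le> C * (2 ^ k / 1) powr (- a) * pmf_tail p 1"
      by (rule C(2)) auto
    also have "\<dots> \<le> C * (2 ^ k / 1) powr (- a) * 1"
      using C(1) regularly_varying_tailD(3)[OF T] by (intro mult_left_mono) auto
    also have "(2 ^ k / 1) powr (- a) = (2 powr (- a)) ^ k"
      by (induction k) (simp_all add: powr_mult)
    finally show "emeasure (measure_pmf p) {x \<in> space (measure_pmf p). 1 * 2 ^ k < real x}
        \<le> ennreal (C * (2 powr (- a)) ^ k)"
      by (simp add: measure_pmf.emeasure_eq_measure pmf_tail_def ennreal_leI)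
  qed (use r C(1) ratio in \<open>auto simp: measure_pmf.prob_space_axioms\<close>)
  moreover have "0 \<le> C / (1 - 2 powr r * 2 powr (- a))" using C(1) ratio by simp
  then have "0 \<le> 2 powr r * (C / (1 - 2 powr r * 2 powr (- a)))" by (intro mult_nonneg_nonneg) auto
  ultimately show thesis
    by (intro that[of "1 powr r * (1 + 2 powr r * C / (1 - 2 powr r * 2 powr (- a)))"]) auto
qed

section \<open>Exponential moments of a truncated offspring number\<close>

lemma exp_le_quadratic:
  fixes u B :: real
  assumes "0 \<le> u" "u \<le> B"
  shows "exp u \<le> 1 + u + exp B * u\<^sup>2"
proof -
  obtain t where t: "\<bar>t\<bar> \<le> \<bar>u\<bar>" "exp u = (\<Sum>m<2. (u ^ m) / fact m) + (exp t / fact 2) * u ^ 2"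
    using Maclaurin_exp_le[of u 2] by blast
  have "exp t / 2 * u\<^sup>2 \<le> exp B * u\<^sup>2"
  proof (intro mult_right_mono)
    have "exp t \<le> exp B" "0 < exp B" using t(1) assms by auto
    then show "exp t / 2 \<le> exp B" by linarith
  qed auto
  then show ?thesis using t(2) by (simp add: numeral_2_eq_2)
qed

text \<open>In the second-order expansion of exp, the linear term is bounded with the untruncated
  mean. The quadratic term would call for a second moment; truncation trades its missing part for
  the power t^(2-r).\<close>

lemma truncated_mgf_bound:
  fixes p :: "nat pmf"
  assumes int: "integrable (measure_pmf p) real" and mean: "m = measure_pmf.expectation p real"
    and r: "0 \<le> r" "r \<le> 2" and K: "0 \<le> K" "(\<integral>\<^sup>+k. ennreal (real k powr r) \<partial>measure_pmf p) \<le> ennreal K"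
    and t: "0 < t" and l: "0 \<le> l"
  shows "(\<integral>\<^sup>+k. ennreal (exp (l * min (real k) t)) \<partial>measure_pmf p)
    \<le> ennreal (exp (l * m + l\<^sup>2 * exp (l * t) * t powr (2 - r) * K))"
proof -
  let ?D = "l\<^sup>2 * exp (l * t) * t powr (2 - r)"
  have m0: "0 \<le> m" unfolding mean by (intro integral_nonneg_AE) auto
  have pw: "exp (l * min (real k) t) \<le> 1 + l * real k + ?D * real k powr r" for k
  proof -
    define u where "u = min (real k) t"
    have u: "0 \<le> u" "u \<le> t" "u \<le> real k" using t by (auto simp: u_def)
    have "exp (l * u) \<le> 1 + l * u + exp (l * t) * (l * u)\<^sup>2"
      using u l by (intro exp_le_quadratic mult_left_mono) auto
    \<comment> \<open>Split u^2 into u^(2-r) and u^r, then use u \<le> t in the first factor and u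
      \<le> k in the second.\<close>
    moreover have "u\<^sup>2 \<le> t powr (2 - r) * real k powr r"
    proof (cases "u = 0")
      case False
      then have "u\<^sup>2 = u powr (2 - r) * u powr r"
        using u by (simp add: powr_add[symmetric] powr_numeral[symmetric] del: powr_numeral)
      also have "\<dots> \<le> t powr (2 - r) * real k powr r"
        using u r by (intro mult_mono powr_mono2) auto
      finally show ?thesis .
    qed auto
    then have "(exp (l * t) * l\<^sup>2) * u\<^sup>2 \<le> (exp (l * t) * l\<^sup>2) * (t powr (2 - r) * real k powr r)"
      by (rule mult_left_mono) auto
    moreover have "l * u \<le> l * real k" using u l by (intro mult_left_mono) auto
    moreover have "exp (l * t) * (l * u)\<^sup>2 = (exp (l * t) * l\<^sup>2) * u\<^sup>2"
      by (simp add: power_mult_distrib)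
    moreover have "?D * real k powr r = (exp (l * t) * l\<^sup>2) * (t powr (2 - r) * real k powr r)"
      by simp
    ultimately show ?thesis unfolding u_def by linarith
  qed
  have "(\<integral>\<^sup>+k. ennreal (exp (l * min (real k) t)) \<partial>measure_pmf p)
      \<le> (\<integral>\<^sup>+k. 1 + ennreal l * ennreal (real k) + ennreal ?D * ennreal (real k powr r) \<partial>measure_pmf p)"
    using pw l by (intro nn_integral_mono)
      (auto simp: ennreal_mult[symmetric] ennreal_plus[symmetric] ennreal_1[symmetric]
        simp del: ennreal_plus ennreal_1 intro!: ennreal_leI)
  also have "\<dots> = 1 + ennreal l * (\<integral>\<^sup>+k. ennreal (real k) \<partial>measure_pmf p)
      + ennreal ?D * (\<integral>\<^sup>+k. ennreal (real k powr r) \<partial>measure_pmf p)"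
    by (simp add: nn_integral_add nn_integral_cmult)
  also have "(\<integral>\<^sup>+k. ennreal (real k) \<partial>measure_pmf p) = ennreal m"
    unfolding mean by (intro nn_integral_eq_integral int) auto
  also have "1 + ennreal l * ennreal m + ennreal ?D * (\<integral>\<^sup>+k. ennreal (real k powr r) \<partial>measure_pmf p)
      \<le> 1 + ennreal l * ennreal m + ennreal ?D * ennreal K"
    by (intro add_left_mono mult_left_mono K) auto
  also have "\<dots> = ennreal (1 + (l * m + ?D * K))"
    using l m0 K(1) by (simp add: ennreal_mult ennreal_plus add.assoc)
  also have "\<dots> \<le> ennreal (exp (l * m + ?D * K))"
    by (intro ennreal_leI exp_ge_add_one_self)
  finally show ?thesis .
qed

lemma truncated_mean_tendsto:
  assumes int: "integrable (measure_pmf p) real"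
  shows "(\<lambda>n. measure_pmf.expectation p (\<lambda>k. min (real k) (real n)))
    \<longlonglongrightarrow> measure_pmf.expectation p real"
proof (rule integral_dominated_convergence[where w = real])
  show "AE k in measure_pmf p. (\<lambda>n. min (real k) (real n)) \<longlonglongrightarrow> real k"
  proof (intro AE_I2)
    fix k
    have "eventually (\<lambda>n. min (real k) (real n) = real k) sequentially"
      using eventually_ge_at_top[of k] by eventually_elim auto
    then show "(\<lambda>n. min (real k) (real n)) \<longlonglongrightarrow> real k" by (rule tendsto_eventually)
  qed
qed (use int in auto)

text \<open>A second-order Bonferroni bound for k independent events of probability x. The quadratic
  coefficient is generous, which lets the induction close after dropping the cubic term.\<close>

lemma one_minus_power_le:
  fixes x :: real
  assumes "0 \<le> x" "x \<le> 1"
  shows "(1 - x) ^ k \<le> 1 - real k * x + (real k * x)\<^sup>2"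
proof (induction k)
  case (Suc k)
  have "(1 - x) ^ Suc k \<le> (1 - real k * x + (real k * x)\<^sup>2) * (1 - x)"
    using mult_right_mono[OF Suc, of "1 - x"] assms by (simp add: mult_ac)
  also have "\<dots> = 1 - real (Suc k) * x + real k * x\<^sup>2 + (real k * x)\<^sup>2 - (real k)\<^sup>2 * x ^ 3"
    by (simp add: algebra_simps power2_eq_square power3_eq_cube)
  also have "\<dots> \<le> 1 - real (Suc k) * x + real k * x\<^sup>2 + (real k * x)\<^sup>2"
    using assms by simp
  also have "\<dots> \<le> 1 - real (Suc k) * x + (real (Suc k) * x)\<^sup>2"
  proof -
    have "(real (Suc k) * x)\<^sup>2 = (real k * x)\<^sup>2 + 2 * (real k * x\<^sup>2) + x\<^sup>2"
      by (simp add: algebra_simps power2_eq_square)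
    moreover have "0 \<le> real k * x\<^sup>2" by simp
    moreover have "0 \<le> x\<^sup>2" by simp
    ultimately show ?thesis by linarith
  qed
  finally show ?case .
qed simp

text \<open>Because \<beta> > 1, Potter's bound from base point 1 gives decay with an exponent a >
  1. Hence the expected number of summands of order k among k of them vanishes.\<close>

lemma regularly_varying_tail_times_id_tendsto_0:
  assumes T: "regularly_varying_tail \<beta> T" and "1 < \<beta>" "0 < c"
  shows "(\<lambda>k. real k * T (c * real k)) \<longlonglongrightarrow> 0"
proof -
  define a where "a = (1 + \<beta>) / 2"
  have a: "1 < a" "a < \<beta>" using assms by (auto simp: a_def)
  then obtain C where C: "0 < C"
    "\<And>x y. 1 \<le> x \<Longrightarrow> x \<le> y \<Longrightarrow> T y \<le> C * (y / x) powr (- a) * T x"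
    using potter_upper[OF T, of a] by auto
  have "eventually (\<lambda>k. 1 \<le> c * real k) sequentially"
    using \<open>0 < c\<close> by real_asymp
  then have ev: "eventually (\<lambda>k. real k * T (c * real k) \<le> C * c powr (- a) * real k powr (1 - a)) sequentially"
    using eventually_gt_at_top[of 0]
  proof eventually_elim
    case (elim k)
    have "T (c * real k) \<le> C * (c * real k) powr (- a) * T 1"
      using C(2)[of 1 "c * real k"] elim by simp
    also have "\<dots> \<le> C * (c * real k) powr (- a) * 1"
      using C(1) regularly_varying_tailD(3)[OF T] by (intro mult_left_mono) auto
    finally have "real k * T (c * real k) \<le> real k * (C * (c powr (- a) * real k powr (- a)))"
      by (simp add: powr_mult mult_left_mono)
    also have "\<dots> = C * c powr (- a) * real k powr (1 - a)"
      using elim(2) powr_mult_base[of "real k" "- a"] by (simp add: algebra_simps)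
    finally show ?case .
  qed
  have "(\<lambda>k. C * c powr (- a) * real k powr (1 - a)) \<longlonglongrightarrow> 0"
    using a by real_asymp
  from tendsto_sandwich[OF _ ev tendsto_const this] show ?thesis
    using less_imp_le[OF regularly_varying_tailD(2)[OF T]] by auto
qed

section \<open>Large deviations of heavy-tailed sums\<close>

locale iid_nat = prob_space M for M :: "'a measure" +
  fixes X :: "nat \<Rightarrow> 'a \<Rightarrow> nat" and p :: "nat pmf"
  assumes indep: "indep_vars (\<lambda>_. count_space UNIV) X UNIV"
    and distr: "distr M (count_space UNIV) (X i) = measure_pmf p"
begin

lemma measurable_X [measurable]: "X i \<in> measurable M (count_space UNIV)"
  using indep by (auto simp: indep_vars_def)

lemma prob_X: "prob {x \<in> space M. P (X i x)} = measure_pmf.prob p {k. P k}"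
proof -
  have "measure (distr M (count_space UNIV) (X i)) {k. P k} = prob (X i -` {k. P k} \<inter> space M)"
    by (rule measure_distr) auto
  moreover have "X i -` {k. P k} \<inter> space M = {x \<in> space M. P (X i x)}" by auto
  ultimately show ?thesis by (simp add: distr)
qed

lemma nn_integral_X: "(\<integral>\<^sup>+x. f (X i x) \<partial>M) = (\<integral>\<^sup>+k. f k \<partial>measure_pmf p)"
  by (simp add: distr[symmetric, of i] nn_integral_distr)

lemma expectation_X: "expectation (\<lambda>x. f (X i x)) = measure_pmf.expectation p f" for f :: "nat \<Rightarrow> real"
  by (simp add: distr[symmetric, of i] integral_distr)

section \<open>Probabilities of one or two large summands\<close>

lemma prob_exists_large_le:
  "prob {x \<in> space M. \<exists>i<k. u < real (X i x)} \<le> real k * pmf_tail p u"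
proof -
  have "{x \<in> space M. \<exists>i<k. u < real (X i x)} = (\<Union>i<k. {x \<in> space M. u < real (X i x)})"
    by auto
  also have "prob \<dots> \<le> (\<Sum>i<k. prob {x \<in> space M. u < real (X i x)})"
    by (intro finite_measure_subadditive_finite) auto
  also have "\<dots> = real k * pmf_tail p u"
    by (simp add: prob_X[where P = "\<lambda>k. u < real k"] pmf_tail_def)
  finally show ?thesis .
qed

lemma prob_exists_large_ge:
  "real k * pmf_tail p u - (real k * pmf_tail p u)\<^sup>2 \<le> prob {x \<in> space M. \<exists>i<k. u < real (X i x)}"
proof (cases "k = 0")
  case False
  have "prob (space M - {x \<in> space M. \<exists>i<k. u < real (X i x)})
      = prob (\<Inter>i\<in>{..<k}. X i -` {j. \<not> u < real j} \<inter> space M)"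
    using False by (intro arg_cong[where f = prob]) auto
  also have "\<dots> = (\<Prod>i<k. prob (X i -` {j. \<not> u < real j} \<inter> space M))"
    using False by (intro indep_varsD[OF indep]) auto
  also have "\<dots> = (1 - pmf_tail p u) ^ k"
  proof -
    have "prob (X i -` {j. \<not> u < real j} \<inter> space M) = 1 - pmf_tail p u" for i
    proof -
      have "X i -` {j. \<not> u < real j} \<inter> space M = {x \<in> space M. \<not> u < real (X i x)}" by auto
      moreover have "{k. \<not> u < real k} = UNIV - {k. u < real k}" by auto
      ultimately show ?thesis
        using measure_pmf.prob_compl[of "{k. u < real k}" p]
        by (simp add: prob_X[where P = "\<lambda>k. \<not> u < real k"] pmf_tail_def)
    qed
    then show ?thesis by simp
  qed
  also have "\<dots> \<le> 1 - real k * pmf_tail p u + (real k * pmf_tail p u)\<^sup>2"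
    by (intro one_minus_power_le) (auto simp: pmf_tail_def)
  finally show ?thesis
    by (subst (asm) prob_compl) auto
qed simp

text \<open>A union bound over fewer than k^2 pairs, each contributing a square by independence. At
  thresholds proportional to k this is of smaller order than a single jump.\<close>

lemma prob_two_large_le:
  "prob {x \<in> space M. \<exists>i<k. \<exists>j<i. u < real (X i x) \<and> u < real (X j x)}
    \<le> (real k * pmf_tail p u)\<^sup>2"
proof -
  have pair: "prob {x \<in> space M. u < real (X i x) \<and> u < real (X j x)} = (pmf_tail p u)\<^sup>2"
    if "i \<noteq> j" for i j
  proof -
    have "{x \<in> space M. u < real (X i x) \<and> u < real (X j x)}
        = (\<Inter>l\<in>{i, j}. X l -` {n. u < real n} \<inter> space M)" by auto
    also have "prob \<dots> = (\<Prod>l\<in>{i, j}. prob (X l -` {n. u < real n} \<inter> space M))"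
      by (intro indep_varsD[OF indep]) auto
    also have "\<dots> = (\<Prod>l\<in>{i, j}. pmf_tail p u)"
    proof (rule prod.cong)
      fix l
      have "X l -` {n. u < real n} \<inter> space M = {x \<in> space M. u < real (X l x)}" by auto
      then show "prob (X l -` {n. u < real n} \<inter> space M) = pmf_tail p u"
        by (simp add: prob_X[where P = "\<lambda>k. u < real k"] pmf_tail_def)
    qed simp
    finally show ?thesis using that by (simp add: power2_eq_square)
  qed
  have "{x \<in> space M. \<exists>i<k. \<exists>j<i. u < real (X i x) \<and> u < real (X j x)}
      = (\<Union>i<k. \<Union>j<i. {x \<in> space M. u < real (X i x) \<and> u < real (X j x)})"
    by auto
  also have "prob \<dots> \<le> (\<Sum>i<k. prob (\<Union>j<i. {x \<in> space M. u < real (X i x) \<and> u < real (X j x)}))"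
    by (intro finite_measure_subadditive_finite) auto
  also have "\<dots> \<le> (\<Sum>i<k. \<Sum>j<i. prob {x \<in> space M. u < real (X i x) \<and> u < real (X j x)})"
    by (intro sum_mono finite_measure_subadditive_finite) auto
  also have "\<dots> = (\<Sum>i<k. \<Sum>j<i. (pmf_tail p u)\<^sup>2)"
    by (intro sum.cong pair) auto
  also have "\<dots> \<le> (\<Sum>i<k. real k * (pmf_tail p u)\<^sup>2)"
    by (intro sum_mono) (auto intro!: mult_right_mono)
  also have "\<dots> = (real k * pmf_tail p u)\<^sup>2"
    by (simp add: power2_eq_square)
  finally show ?thesis .
qed

text \<open>Chernoff's bound with the truncated exponential moment: the contributions of l m cancel,
  leaving the gain l \<delta> k against the second-order term. The parameter l stays free so that it
  can be tuned to k.\<close>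

lemma prob_truncated_sum_ge_le:
  assumes int: "integrable (measure_pmf p) real" and mean: "m = measure_pmf.expectation p real"
    and r: "0 \<le> r" "r \<le> 2" and K: "0 \<le> K" "(\<integral>\<^sup>+k. ennreal (real k powr r) \<partial>measure_pmf p) \<le> ennreal K"
    and t: "0 < t" and l: "0 < l"
  shows "prob {x \<in> space M. (m + \<delta>) * real k \<le> (\<Sum>i<k. min (real (X i x)) t)}
    \<le> exp (- l * \<delta> * real k + real k * (l\<^sup>2 * exp (l * t) * t powr (2 - r) * K))"
proof -
  let ?B = "l * m + l\<^sup>2 * exp (l * t) * t powr (2 - r) * K"
  let ?S = "\<lambda>x. \<Sum>i<k. min (real (X i x)) t"
  have "emeasure M {x \<in> space M. ?S x \<ge> (m + \<delta>) * real k}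
      \<le> ennreal (exp (- l * ((m + \<delta>) * real k))) * (\<integral>\<^sup>+x. ennreal (exp (l * ?S x)) * indicator (space M) x \<partial>M)"
    using l by (intro Chernoff_ineq_nn_integral_ge) auto
  also have "(\<integral>\<^sup>+x. ennreal (exp (l * ?S x)) * indicator (space M) x \<partial>M)
      = (\<integral>\<^sup>+x. (\<Prod>i<k. ennreal (exp (l * min (real (X i x)) t))) \<partial>M)"
    by (intro nn_integral_cong) (simp add: sum_distrib_left exp_sum prod_ennreal)
  also have "\<dots> = (\<Prod>i<k. \<integral>\<^sup>+x. ennreal (exp (l * min (real (X i x)) t)) \<partial>M)"
    by (intro indep_vars_nn_integral
        indep_vars_compose2[OF indep_vars_subset[OF indep], where Y = "\<lambda>_ n. ennreal (exp (l * min (real n) t))"]) auto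
  also have "\<dots> = (\<integral>\<^sup>+n. ennreal (exp (l * min (real n) t)) \<partial>measure_pmf p) ^ k"
    by (simp add: nn_integral_X[where f = "\<lambda>n. ennreal (exp (l * min (real n) t))"])
  also have "\<dots> \<le> ennreal (exp ?B) ^ k"
    using truncated_mgf_bound[OF int mean r K t less_imp_le[OF l]] by (intro power_mono) auto
  also have "\<dots> = ennreal (exp (real k * ?B))"
    by (simp add: ennreal_power exp_of_nat_mult)
  finally have "emeasure M {x \<in> space M. ?S x \<ge> (m + \<delta>) * real k}
      \<le> ennreal (exp (- l * ((m + \<delta>) * real k)) * exp (real k * ?B))"
    by (simp add: ennreal_mult mult_left_mono)
  also have "exp (- l * ((m + \<delta>) * real k)) * exp (real k * ?B)
      = exp (- l * \<delta> * real k + real k * (l\<^sup>2 * exp (l * t) * t powr (2 - r) * K))"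
    unfolding exp_add[symmetric] by (intro arg_cong[where f = exp]) (simp add: algebra_simps)
  finally show ?thesis
    by (simp add: emeasure_eq_measure)
qed

text \<open>Hoeffding's inequality for variables in [0, A]. One \<delta> covers the mean lost by
  truncation, the other is the deviation. With A fixed, the bound is exponentially small in
  k.\<close>

lemma prob_truncated_sum_le:
  assumes A: "0 < A" and k: "0 < k" and \<delta>: "0 \<le> \<delta>"
    and mean: "m - \<delta> \<le> measure_pmf.expectation p (\<lambda>k. min (real k) A)"
  shows "prob {x \<in> space M. (\<Sum>i<k. min (real (X i x)) A) \<le> (m - 2 * \<delta>) * real k}
    \<le> exp (- 2 * \<delta>\<^sup>2 / A\<^sup>2 * real k)"
proof -
  have \<mu>: "m - \<delta> \<le> expectation (\<lambda>x. min (real (X 0 x)) A)"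
    using mean by (simp add: expectation_X[where f = "\<lambda>n. min (real n) A"])
  interpret Hoeffding_ineq_iid M "{..<k}" "\<lambda>i x. min (real (X i x)) A" "\<lambda>x. min (real (X 0 x)) A" 0 A
    "expectation (\<lambda>x. min (real (X 0 x)) A)"
  proof unfold_locales
    show "indep_vars (\<lambda>_. borel) (\<lambda>i x. min (real (X i x)) A) {..<k}"
      by (rule indep_vars_compose2[OF indep_vars_subset[OF indep], where Y = "\<lambda>_ n. min (real n) A"]) auto
    fix i
    have "distr M borel (\<lambda>x. min (real (X i x)) A)
        = distr (distr M (count_space UNIV) (X i)) borel (\<lambda>n. min (real n) A)" for i
      by (subst distr_distr) (auto simp: comp_def)
    then show "distr M borel (\<lambda>x. min (real (X i x)) A) = distr M borel (\<lambda>x. min (real (X 0 x)) A)"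
      by (simp add: distr)
  qed (use A in auto)
  have "prob {x \<in> space M. (\<Sum>i<k. min (real (X i x)) A) \<le> (m - 2 * \<delta>) * real k}
      \<le> prob {x \<in> space M. (\<Sum>i<k. min (real (X i x)) A)
        \<le> real (card {..<k}) * expectation (\<lambda>x. min (real (X 0 x)) A) - \<delta> * real k}"
  proof (rule finite_measure_mono)
    have "(m - 2 * \<delta>) * real k \<le> (expectation (\<lambda>x. min (real (X 0 x)) A) - \<delta>) * real k"
      using \<mu> by (intro mult_right_mono) auto
    then show "{x \<in> space M. (\<Sum>i<k. min (real (X i x)) A) \<le> (m - 2 * \<delta>) * real k}
      \<subseteq> {x \<in> space M. (\<Sum>i<k. min (real (X i x)) A)
        \<le> real (card {..<k}) * expectation (\<lambda>x. min (real (X 0 x)) A) - \<delta> * real k}"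
      by (auto simp: algebra_simps)
  qed auto
  also have "\<dots> \<le> exp (- 2 * (\<delta> * real k)\<^sup>2 / (real (card {..<k}) * (A - 0)\<^sup>2))"
    using \<delta> A k by (intro Hoeffding_ineq_le) auto
  also have "- 2 * (\<delta> * real k)\<^sup>2 / (real (card {..<k}) * (A - 0)\<^sup>2) = - 2 * \<delta>\<^sup>2 / A\<^sup>2 * real k"
    using k A by (simp add: power2_eq_square field_simps)
  finally show ?thesis .
qed

text \<open>If no summand exceeds u k and at most one exceeds t, then removing that one costs at
  most u k, and the remaining summands are unchanged by truncation at t. With u just below
  \<epsilon>, the first term is the main one.\<close>

lemma prob_sum_ge_le:
  assumes u: "0 \<le> u" and t: "0 < t"
  shows "prob {x \<in> space M. (m + \<epsilon>) * real k \<le> (\<Sum>i<k. real (X i x))}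
    \<le> real k * pmf_tail p (u * real k) + (real k * pmf_tail p t)\<^sup>2
      + prob {x \<in> space M. (m + (\<epsilon> - u)) * real k \<le> (\<Sum>i<k. min (real (X i x)) t)}"
proof -
  let ?A = "{x \<in> space M. \<exists>i<k. u * real k < real (X i x)}"
  let ?B = "{x \<in> space M. \<exists>i<k. \<exists>j<i. t < real (X i x) \<and> t < real (X j x)}"
  let ?C = "{x \<in> space M. (m + (\<epsilon> - u)) * real k \<le> (\<Sum>i<k. min (real (X i x)) t)}"
  have "{x \<in> space M. (m + \<epsilon>) * real k \<le> (\<Sum>i<k. real (X i x))} \<subseteq> ?A \<union> ?B \<union> ?C"
  proof
    fix x assume "x \<in> {x \<in> space M. (m + \<epsilon>) * real k \<le> (\<Sum>i<k. real (X i x))}"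
    then have x: "x \<in> space M" and S: "(m + \<epsilon>) * real k \<le> (\<Sum>i<k. real (X i x))" by auto
    have "x \<in> ?C" if nA: "x \<notin> ?A" and nB: "x \<notin> ?B"
    proof (cases "\<exists>i<k. t < real (X i x)")
      case True
      then obtain i where i: "i < k" "t < real (X i x)" by auto
      have small: "real (X j x) \<le> t" if "j < k" "j \<noteq> i" for j
        using nB x i that by (metis (mono_tags, lifting) mem_Collect_eq not_le nat_neq_iff)
      have "(\<Sum>j<k. real (X j x)) = real (X i x) + (\<Sum>j\<in>{..<k} - {i}. real (X j x))"
        using i by (intro sum.remove) auto
      also have "(\<Sum>j\<in>{..<k} - {i}. real (X j x)) = (\<Sum>j\<in>{..<k} - {i}. min (real (X j x)) t)"
        using small by (intro sum.cong) auto
      also have "\<dots> \<le> (\<Sum>j<k. min (real (X j x)) t)"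
        using t by (intro sum_mono2) auto
      also have "real (X i x) \<le> u * real k" using nA x i(1) by (auto simp: not_less dest!: spec[of _ i])
      finally show ?thesis using S x by (simp add: algebra_simps)
    next
      case False
      then have "(\<Sum>j<k. min (real (X j x)) t) = (\<Sum>j<k. real (X j x))"
        by (intro sum.cong refl min_absorb1) (meson lessThan_iff not_less)
      moreover have "(m + (\<epsilon> - u)) * real k \<le> (m + \<epsilon>) * real k"
        using u by (intro mult_right_mono) auto
      ultimately show ?thesis using S x by auto
    qed
    then show "x \<in> ?A \<union> ?B \<union> ?C" by blast
  qed
  then have "prob {x \<in> space M. (m + \<epsilon>) * real k \<le> (\<Sum>i<k. real (X i x))} \<le> prob (?A \<union> ?B \<union> ?C)"
    by (intro finite_measure_mono) auto
  also have "\<dots> \<le> prob ?A + prob ?B + prob ?C"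
    by (intro order.trans[OF measure_Un_le] add_mono measure_Un_le order_refl) auto
  finally show ?thesis
    using prob_exists_large_le[of k "u * real k"] prob_two_large_le[of k t] by linarith
qed

text \<open>A jump above v k lifts the sum past the threshold unless the truncated sum is too small.
  Truncation keeps the jump's share of that sum below A, and the hypothesis on A says that the
  surplus v - \<epsilon> pays for A and for the deficit 2 \<delta>.\<close>

lemma prob_sum_ge_ge:
  assumes A: "0 < A" "A \<le> (v - \<epsilon> - 2 * \<delta>) * real k"
  shows "real k * pmf_tail p (v * real k) - (real k * pmf_tail p (v * real k))\<^sup>2
      - prob {x \<in> space M. (\<Sum>i<k. min (real (X i x)) A) \<le> (m - 2 * \<delta>) * real k}
    \<le> prob {x \<in> space M. (m + \<epsilon>) * real k \<le> (\<Sum>i<k. real (X i x))}"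
proof -
  let ?A = "{x \<in> space M. \<exists>i<k. v * real k < real (X i x)}"
  let ?C = "{x \<in> space M. (\<Sum>i<k. min (real (X i x)) A) \<le> (m - 2 * \<delta>) * real k}"
  let ?S = "{x \<in> space M. (m + \<epsilon>) * real k \<le> (\<Sum>i<k. real (X i x))}"
  have "?A \<subseteq> ?S \<union> ?C"
  proof
    fix x assume "x \<in> ?A"
    then obtain i where x: "x \<in> space M" and i: "i < k" "v * real k < real (X i x)" by auto
    have "x \<in> ?S" if "x \<notin> ?C"
    proof -
      have "(\<Sum>j<k. min (real (X j x)) A) = min (real (X i x)) A + (\<Sum>j\<in>{..<k} - {i}. min (real (X j x)) A)"
        using i by (intro sum.remove) auto
      also have "\<dots> \<le> A + (\<Sum>j\<in>{..<k} - {i}. real (X j x))"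
        by (intro add_mono sum_mono) auto
      also have "(\<Sum>j\<in>{..<k} - {i}. real (X j x)) = (\<Sum>j<k. real (X j x)) - real (X i x)"
        using i by (simp add: sum_diff1)
      finally show ?thesis using that x i A by (auto simp: algebra_simps)
    qed
    then show "x \<in> ?S \<union> ?C" by blast
  qed
  then have "prob ?A \<le> prob (?S \<union> ?C)" by (intro finite_measure_mono) auto
  also have "\<dots> \<le> prob ?S + prob ?C" by (intro measure_Un_le) auto
  finally show ?thesis using prob_exists_large_ge[of k "v * real k"] by linarith
qed

text \<open>Choosing \<open>\<eta>\<close> small and \<open>l = 4 ln k / (\<delta> k)\<close> in the exponential bound
  makes the exponent \<open>- 4 ln k + o(1)\<close>.\<close>

lemma prob_truncated_sum_ge_eventually_le:
  assumes T: "regularly_varying_tail \<beta> (pmf_tail p)" and \<beta>: "1 < \<beta>" "\<beta> < 2"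
    and int: "integrable (measure_pmf p) real" and mean: "m = measure_pmf.expectation p real"
    and \<delta>: "0 < \<delta>"
  obtains \<eta> where "0 < \<eta>"
    "eventually (\<lambda>k. prob {x \<in> space M. (m + \<delta>) * real k \<le> (\<Sum>i<k. min (real (X i x)) (\<eta> * real k))}
      \<le> exp 1 * real k powr (- 4)) sequentially"
proof -
  \<comment> \<open>Here r is the midpoint of 1 and \<beta>, and \<eta> is chosen so that exp(l
    \<eta> k) = k^d. The powers of k in the error then add up to 1 - 2 + d + (1 - 2d) = -d, which
    beats the squared logarithm.\<close>
  define d where "d = (\<beta> - 1) / 4"
  define r where "r = 1 + 2 * d"
  define \<eta> where "\<eta> = d * \<delta> / 4"
  have d: "0 < d" "d < 1 / 4" and r: "0 \<le> r" "r \<le> 2" "r < \<beta>" and \<eta>: "0 < \<eta>"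
    using \<beta> \<delta> by (auto simp: d_def r_def \<eta>_def field_simps)
  obtain K where K: "0 \<le> K" "(\<integral>\<^sup>+k. ennreal (real k powr r) \<partial>measure_pmf p) \<le> ennreal K"
    using pmf_tail_moment_bound[OF T r(1,3)] by blast
  define l where "l k = 4 * ln (real k) / (\<delta> * real k)" for k
  define rest where "rest k = real k * ((l k)\<^sup>2 * exp (l k * (\<eta> * real k)) * (\<eta> * real k) powr (2 - r) * K)" for k
  have "eventually (\<lambda>k. rest k = (16 / \<delta>\<^sup>2 * \<eta> powr (1 - 2 * d) * K) * ((ln (real k))\<^sup>2 * real k powr (- d))) sequentially"
    using eventually_gt_at_top[of 1]
  proof eventually_elim
    case (elim k)
    have e: "exp (l k * (\<eta> * real k)) = real k powr d"
      using elim \<delta> by (simp add: l_def \<eta>_def powr_def)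
    have "real k powr 1 * (real k powr d * real k powr (1 - 2 * d)) = real k powr 2 * real k powr (- d)"
      by (simp only: powr_add[symmetric]) simp
    then have pw: "real k * (real k powr d * real k powr (1 - 2 * d)) = (real k)\<^sup>2 * real k powr (- d)"
      using elim by simp
    have sq: "(l k)\<^sup>2 * (real k)\<^sup>2 = 16 / \<delta>\<^sup>2 * (ln (real k))\<^sup>2"
      using elim \<delta> by (simp add: l_def power_mult_distrib power_divide)
    have "rest k = (l k)\<^sup>2 * (\<eta> powr (1 - 2 * d) * (real k * (real k powr d * real k powr (1 - 2 * d)))) * K"
      by (simp add: rest_def e r_def powr_mult)
    also have "\<dots> = ((l k)\<^sup>2 * (real k)\<^sup>2) * (\<eta> powr (1 - 2 * d) * real k powr (- d)) * K"
      unfolding pw by (simp only: mult_ac)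
    finally show ?case unfolding sq by (simp only: mult_ac)
  qed
  moreover have "(\<lambda>k. (16 / \<delta>\<^sup>2 * \<eta> powr (1 - 2 * d) * K) * ((ln (real k))\<^sup>2 * real k powr (- d)))
      \<longlonglongrightarrow> (16 / \<delta>\<^sup>2 * \<eta> powr (1 - 2 * d) * K) * 0"
  proof (rule tendsto_mult_left)
    show "(\<lambda>k. (ln (real k))\<^sup>2 * real k powr (- d)) \<longlonglongrightarrow> 0" using d(1) by real_asymp
  qed
  ultimately have "rest \<longlonglongrightarrow> 0"
    using tendsto_cong by force
  then have ev: "eventually (\<lambda>k. rest k < 1) sequentially"
    by (rule order_tendstoD) simp
  show thesis
  proof (rule that[OF \<eta>])
    show "eventually (\<lambda>k. prob {x \<in> space M. (m + \<delta>) * real k \<le> (\<Sum>i<k. min (real (X i x)) (\<eta> * real k))}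
      \<le> exp 1 * real k powr (- 4)) sequentially"
      using ev eventually_gt_at_top[of 1]
    proof eventually_elim
      case (elim k)
      have "prob {x \<in> space M. (m + \<delta>) * real k \<le> (\<Sum>i<k. min (real (X i x)) (\<eta> * real k))}
        \<le> exp (- l k * \<delta> * real k + rest k)"
        unfolding rest_def using elim(2) \<eta> \<delta>
        by (intro prob_truncated_sum_ge_le int mean r K) (auto simp: l_def)
      also have "\<dots> \<le> exp (- l k * \<delta> * real k + 1)" using elim by simp
      also have "- l k * \<delta> * real k = - 4 * ln (real k)" using elim \<delta> by (simp add: l_def)
      also have "exp (- 4 * ln (real k) + 1) = exp 1 * real k powr (- 4)"
        using elim by (simp add: powr_def exp_add[symmetric])
      finally show ?case .
    qed
  qed
qed

text \<open>The upper bound uses a jump level u k with u below \<epsilon>, the lower one a level v k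
  with v above \<epsilon>. Regular variation turns these into u powr (-\<beta>) and v powr
  (-\<beta>), and continuity at \<epsilon> closes the gap.\<close>

theorem large_deviation_heavy_tail:
  assumes T: "regularly_varying_tail \<beta> (pmf_tail p)" and \<beta>: "1 < \<beta>" "\<beta> < 2"
    and int: "integrable (measure_pmf p) real" and mean: "m = measure_pmf.expectation p real"
    and \<epsilon>: "0 < \<epsilon>"
  shows "(\<lambda>k. prob {x \<in> space M. (m + \<epsilon>) * real k \<le> (\<Sum>i<k. real (X i x))}
      / (real k * pmf_tail p (real k))) \<longlonglongrightarrow> \<epsilon> powr (- \<beta>)"
proof -
  let ?T = "pmf_tail p"
  let ?P = "\<lambda>k. prob {x \<in> space M. (m + \<epsilon>) * real k \<le> (\<Sum>i<k. real (X i x))}"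
  have T_pos: "0 < ?T x" for x using regularly_varying_tailD(2)[OF T] .
  have ratio: "(\<lambda>k. ?T (c * real k) / ?T (real k)) \<longlonglongrightarrow> c powr (- \<beta>)" if "0 < c" for c
    using regularly_varying_tail_tendsto[OF T filterlim_real_sequentially tendsto_const that] .
  \<comment> \<open>The square leaves one factor k T(ck), which vanishes as \<beta> > 1, times a
    convergent ratio of tails.\<close>
  have small: "(\<lambda>k. (real k * ?T (c * real k))\<^sup>2 / (real k * ?T (real k))) \<longlonglongrightarrow> 0" if "0 < c" for c
  proof -
    have "(\<lambda>k. real k * ?T (c * real k) * (?T (c * real k) / ?T (real k))) \<longlonglongrightarrow> 0 * c powr (- \<beta>)"
      by (intro tendsto_mult ratio regularly_varying_tail_times_id_tendsto_0[OF T \<beta>(1)] that)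
    moreover have "eventually (\<lambda>k. real k * ?T (c * real k) * (?T (c * real k) / ?T (real k))
      = (real k * ?T (c * real k))\<^sup>2 / (real k * ?T (real k))) sequentially"
      using eventually_gt_at_top[of 0] by eventually_elim (simp add: power2_eq_square)
    ultimately show ?thesis using tendsto_cong by force
  qed
  \<comment> \<open>Exponent 2 is admissible because \<beta> < 2; it keeps k T(k) above a multiple
    of 1/k, so any error that is o(1/k) is negligible.\<close>
  obtain C where C: "0 < C"
    "\<And>x y. 1 \<le> x \<Longrightarrow> x \<le> y \<Longrightarrow> ?T x \<le> C * (y / x) powr 2 * ?T y"
    using potter_lower[OF T, of 2] \<beta> by auto
  have negligible: "(\<lambda>k. R k / (real k * ?T (real k))) \<longlonglongrightarrow> 0"
    if R: "\<And>k. 0 \<le> R k" "(\<lambda>k. real k * R k) \<longlonglongrightarrow> 0" for R :: "nat \<Rightarrow> real"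
  proof (rule tendsto_sandwich[OF _ _ tendsto_const])
    show "eventually (\<lambda>k. 0 \<le> R k / (real k * ?T (real k))) sequentially"
      using R(1) less_imp_le[OF T_pos] by (auto intro!: always_eventually)
    show "eventually (\<lambda>k. R k / (real k * ?T (real k)) \<le> C / ?T 1 * (real k * R k)) sequentially"
      using eventually_gt_at_top[of 0]
    proof eventually_elim
      case (elim k)
      have "?T 1 \<le> C * (real k)\<^sup>2 * ?T (real k)"
        using C(2)[of 1 "real k"] elim by (simp add: powr_numeral)
      then have "R k * ?T 1 \<le> R k * (C * (real k)\<^sup>2 * ?T (real k))"
        by (intro mult_left_mono R)
      then show ?case
        using elim T_pos[of 1] T_pos[of "real k"] by (simp add: field_simps power2_eq_square)
    qed
    show "(\<lambda>k. C / ?T 1 * (real k * R k)) \<longlonglongrightarrow> 0"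
      using tendsto_mult_left[OF R(2), of "C / ?T 1"] by simp
  qed
  have cont: "((\<lambda>c. c powr (- \<beta>)) \<longlongrightarrow> \<epsilon> powr (- \<beta>)) (nhds \<epsilon>)"
    using \<epsilon> by (intro tendsto_powr filterlim_ident tendsto_const) auto
  show ?thesis
  proof (rule order_tendstoI)
    fix a assume a: "\<epsilon> powr (- \<beta>) < a"
    have "eventually (\<lambda>u. u powr (- \<beta>) < a) (at_left \<epsilon>)"
      using order_tendstoD(2)[OF cont a] filter_leD[OF at_within_le_nhds] by blast
    moreover have "eventually (\<lambda>u. 0 < u \<and> u < \<epsilon>) (at_left \<epsilon>)"
      using eventually_at_left_real[OF \<epsilon>] by (rule eventually_mono) auto
    ultimately have "eventually (\<lambda>u. u powr (- \<beta>) < a \<and> 0 < u \<and> u < \<epsilon>) (at_left \<epsilon>)"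
      by eventually_elim auto
    then obtain u where u: "u powr (- \<beta>) < a" "0 < u" "u < \<epsilon>"
      using eventually_happens'[OF trivial_limit_at_left_real] by blast
    have "0 < \<epsilon> - u" using u by simp
    from prob_truncated_sum_ge_eventually_le[OF T \<beta> int mean this] obtain \<eta> where \<eta>: "0 < \<eta>"
      "eventually (\<lambda>k. prob {x \<in> space M. (m + (\<epsilon> - u)) * real k \<le> (\<Sum>i<k. min (real (X i x)) (\<eta> * real k))}
        \<le> exp 1 * real k powr (- 4)) sequentially" by blast
    let ?h = "\<lambda>k. ?T (u * real k) / ?T (real k) + (real k * ?T (\<eta> * real k))\<^sup>2 / (real k * ?T (real k))
        + (exp 1 * real k powr (- 4)) / (real k * ?T (real k))"
    have "?h \<longlonglongrightarrow> u powr (- \<beta>) + 0 + 0"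
    proof (intro tendsto_add ratio small negligible)
      show "(\<lambda>k. real k * (exp 1 * real k powr (- 4))) \<longlonglongrightarrow> 0" by real_asymp
    qed (use u \<eta> in auto)
    then have "eventually (\<lambda>k. ?h k < a) sequentially"
      using u by (intro order_tendstoD) auto
    then show "eventually (\<lambda>k. ?P k / (real k * ?T (real k)) < a) sequentially"
      using \<eta>(2) eventually_gt_at_top[of 0]
    proof eventually_elim
      case (elim k)
      have "?P k \<le> real k * ?T (u * real k) + (real k * ?T (\<eta> * real k))\<^sup>2 + exp 1 * real k powr (- 4)"
        using prob_sum_ge_le[OF less_imp_le[OF u(2)], of "\<eta> * real k" m \<epsilon> k] \<eta>(1) elim by simp
      then have "?P k / (real k * ?T (real k)) \<le> (real k * ?T (u * real k)
          + (real k * ?T (\<eta> * real k))\<^sup>2 + exp 1 * real k powr (- 4)) / (real k * ?T (real k))"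
        using less_imp_le[OF T_pos] by (intro divide_right_mono) auto
      also have "\<dots> = ?h k" using elim(3) by (simp add: add_divide_distrib)
      finally show ?case using elim(1) by linarith
    qed
  next
    fix a assume a: "a < \<epsilon> powr (- \<beta>)"
    have "eventually (\<lambda>v. a < v powr (- \<beta>)) (at_right \<epsilon>)"
      using order_tendstoD(1)[OF cont a] filter_leD[OF at_within_le_nhds] by blast
    moreover have "eventually (\<lambda>v. \<epsilon> < v) (at_right \<epsilon>)"
      by (rule eventually_at_right_less)
    ultimately have "eventually (\<lambda>v. a < v powr (- \<beta>) \<and> \<epsilon> < v) (at_right \<epsilon>)"
      by eventually_elim auto
    then obtain v where v: "a < v powr (- \<beta>)" "\<epsilon> < v"
      using eventually_happens'[OF trivial_limit_at_right_real] by blast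
    \<comment> \<open>A quarter of the gap leaves v - \<epsilon> - 2 \<delta> = 2 \<delta>, and this
      times k eventually exceeds the fixed truncation level n obtained below.\<close>
    define \<delta> where "\<delta> = (v - \<epsilon>) / 4"
    have \<delta>: "0 < \<delta>" using v by (simp add: \<delta>_def)
    have "eventually (\<lambda>n. m - \<delta> < measure_pmf.expectation p (\<lambda>k. min (real k) (real n))) sequentially"
      using truncated_mean_tendsto[OF int] \<delta> by (intro order_tendstoD) (auto simp: mean)
    then have "eventually (\<lambda>n. m - \<delta> < measure_pmf.expectation p (\<lambda>k. min (real k) (real n)) \<and> 0 < n) sequentially"
      using eventually_gt_at_top[of 0] by eventually_elim auto
    then obtain n where n: "m - \<delta> < measure_pmf.expectation p (\<lambda>k. min (real k) (real n))" "0 < n"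
      using eventually_happens'[OF sequentially_bot] by blast
    let ?h = "\<lambda>k. ?T (v * real k) / ?T (real k) - (real k * ?T (v * real k))\<^sup>2 / (real k * ?T (real k))
        - exp (- 2 * \<delta>\<^sup>2 / (real n)\<^sup>2 * real k) / (real k * ?T (real k))"
    have "?h \<longlonglongrightarrow> v powr (- \<beta>) - 0 - 0"
    proof (intro tendsto_diff ratio small negligible)
      define c where "c = 2 * \<delta>\<^sup>2 / (real n)\<^sup>2"
      have "0 < c" using \<delta> n by (simp add: c_def)
      then have "(\<lambda>k. real k * exp (- c * real k)) \<longlonglongrightarrow> 0" by real_asymp
      then show "(\<lambda>k. real k * exp (- 2 * \<delta>\<^sup>2 / (real n)\<^sup>2 * real k)) \<longlonglongrightarrow> 0" by (simp add: c_def)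
    qed (use v \<epsilon> in auto)
    then have "eventually (\<lambda>k. a < ?h k) sequentially"
      using v by (intro order_tendstoD) auto
    moreover have "eventually (\<lambda>k. real n \<le> 2 * \<delta> * real k) sequentially"
      using \<delta> by real_asymp
    ultimately show "eventually (\<lambda>k. a < ?P k / (real k * ?T (real k))) sequentially"
      using eventually_gt_at_top[of 0]
    proof eventually_elim
      case (elim k)
      have "real k * ?T (v * real k) - (real k * ?T (v * real k))\<^sup>2
          - prob {x \<in> space M. (\<Sum>i<k. min (real (X i x)) (real n)) \<le> (m - 2 * \<delta>) * real k} \<le> ?P k"
      proof (intro prob_sum_ge_ge)
        have "v - \<epsilon> - 2 * \<delta> = 2 * \<delta>" by (simp add: \<delta>_def field_simps)
        then show "real n \<le> (v - \<epsilon> - 2 * \<delta>) * real k" using elim(2) by simp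
      qed (use n in auto)
      moreover have "prob {x \<in> space M. (\<Sum>i<k. min (real (X i x)) (real n)) \<le> (m - 2 * \<delta>) * real k}
          \<le> exp (- 2 * \<delta>\<^sup>2 / (real n)\<^sup>2 * real k)"
        using n \<delta> elim(3) by (intro prob_truncated_sum_le) auto
      ultimately have "real k * ?T (v * real k) - (real k * ?T (v * real k))\<^sup>2
          - exp (- 2 * \<delta>\<^sup>2 / (real n)\<^sup>2 * real k) \<le> ?P k" by linarith
      then have "(real k * ?T (v * real k) - (real k * ?T (v * real k))\<^sup>2
          - exp (- 2 * \<delta>\<^sup>2 / (real n)\<^sup>2 * real k)) / (real k * ?T (real k)) \<le> ?P k / (real k * ?T (real k))"
        using less_imp_le[OF T_pos] by (intro divide_right_mono) auto
      moreover have "(real k * ?T (v * real k) - (real k * ?T (v * real k))\<^sup>2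
          - exp (- 2 * \<delta>\<^sup>2 / (real n)\<^sup>2 * real k)) / (real k * ?T (real k)) = ?h k"
        using elim(3) by (simp add: diff_divide_distrib)
      ultimately show ?case using elim(1) by linarith
    qed
  qed
qed

end

section \<open>The law of a Galton-Watson process\<close>

primrec iid_sum_pmf :: "nat pmf \<Rightarrow> nat \<Rightarrow> nat pmf" where
  "iid_sum_pmf q 0 = return_pmf 0"
| "iid_sum_pmf q (Suc k) = bind_pmf (iid_sum_pmf q k) (\<lambda>s. map_pmf (\<lambda>j. s + j) q)"

primrec gw_pmf :: "nat pmf \<Rightarrow> nat \<Rightarrow> nat pmf" where
  "gw_pmf p 0 = return_pmf 1"
| "gw_pmf p (Suc n) = bind_pmf (gw_pmf p n) (iid_sum_pmf p)"

lemma iid_sum_pmf_add: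
  "iid_sum_pmf q (a + b) = bind_pmf (iid_sum_pmf q a) (\<lambda>s. map_pmf (\<lambda>j. s + j) (iid_sum_pmf q b))"
proof (induction b)
  case (Suc b)
  have shift: "map_pmf ((+) (x + y)) q = map_pmf (\<lambda>j. x + (y + j)) q" for x y
    by (intro map_pmf_cong) (simp_all add: add.assoc)
  show ?case
    using Suc by (simp add: shift bind_assoc_pmf map_bind_pmf bind_map_pmf pmf.map_comp comp_def)
qed (simp add: bind_return_pmf')

text \<open>In generating functions: substituting f_p into the k-th power of f_q is the same as
  taking the k-th power of the composition of f_q with f_p.\<close>

lemma bind_iid_sum_pmf:
  "bind_pmf (iid_sum_pmf q k) (iid_sum_pmf p) = iid_sum_pmf (bind_pmf q (iid_sum_pmf p)) k"
proof (induction k)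
  case (Suc k)
  have "bind_pmf (iid_sum_pmf q (Suc k)) (iid_sum_pmf p)
      = bind_pmf (iid_sum_pmf q k) (\<lambda>s. bind_pmf q (\<lambda>j.
          bind_pmf (iid_sum_pmf p s) (\<lambda>u. map_pmf (\<lambda>v. u + v) (iid_sum_pmf p j))))"
    by (simp add: bind_assoc_pmf bind_map_pmf iid_sum_pmf_add)
  also have "\<dots> = bind_pmf (iid_sum_pmf q k) (\<lambda>s. bind_pmf (iid_sum_pmf p s) (\<lambda>u.
          bind_pmf q (\<lambda>j. map_pmf (\<lambda>v. u + v) (iid_sum_pmf p j))))"
    \<comment> \<open>The new family's size j and the offspring total u of the earlier ones are
      independent, so the order of drawing is free.\<close>
    by (subst bind_commute_pmf) (rule refl)
  also have "\<dots> = bind_pmf (bind_pmf (iid_sum_pmf q k) (iid_sum_pmf p))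
      (\<lambda>u. map_pmf (\<lambda>v. u + v) (bind_pmf q (iid_sum_pmf p)))"
    by (simp add: bind_assoc_pmf map_bind_pmf)
  finally show ?case by (simp add: Suc)
qed (simp add: bind_return_pmf)

lemma iid_sum_pmf_return_1: "iid_sum_pmf (return_pmf 1) = return_pmf"
proof
  show "iid_sum_pmf (return_pmf 1) k = return_pmf k" for k
    by (induction k) (auto simp: bind_return_pmf)
qed

text \<open>The recursion in \<open>gw_pmf\<close> appends a last generation; this form branches at
  the first, so that generation n+1 is a sum of independent copies of generation n. It is the
  identity between f composed with f_n and f_n composed with f.\<close>

lemma gw_pmf_Suc_first: "gw_pmf p (Suc n) = bind_pmf p (iid_sum_pmf (gw_pmf p n))"
proof (induction n)
  case 0
  have "(\<lambda>j. 0 + j) = (id :: nat \<Rightarrow> nat)" by auto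
  then have "iid_sum_pmf p (Suc 0) = p" by (simp only: iid_sum_pmf.simps bind_return_pmf pmf.map_id)
  then show ?case
    using iid_sum_pmf_return_1 by (simp add: bind_return_pmf bind_return_pmf' del: iid_sum_pmf.simps)
next
  case (Suc n)
  have "gw_pmf p (Suc (Suc n)) = bind_pmf (bind_pmf p (iid_sum_pmf (gw_pmf p n))) (iid_sum_pmf p)"
    using Suc by simp
  then show ?case by (simp add: bind_assoc_pmf bind_iid_sum_pmf)
qed

section \<open>Small values and negative moments of generation sizes\<close>

lemma emeasure_iid_sum_pmf_le:
  "emeasure (iid_sum_pmf q k) {j. real j \<le> y} \<le> emeasure q {j. real j \<le> y} ^ k"
proof (induction k)
  case (Suc k)
  have "emeasure (iid_sum_pmf q (Suc k)) {j. real j \<le> y}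
      = (\<integral>\<^sup>+s. emeasure (map_pmf (\<lambda>j. s + j) q) {j. real j \<le> y} \<partial>iid_sum_pmf q k)"
    by (simp add: emeasure_bind_pmf)
  also have "\<dots> \<le> (\<integral>\<^sup>+s. emeasure q {j. real j \<le> y} * indicator {j. real j \<le> y} s \<partial>iid_sum_pmf q k)"
  proof (intro nn_integral_mono)
    fix s
    have "emeasure q {j. real (s + j) \<le> y} \<le> emeasure q {j. real j \<le> y} * indicator {j. real j \<le> y} s"
    proof (cases "real s \<le> y")
      case True
      then show ?thesis by (auto intro!: emeasure_mono)
    next
      case False
      then have "{j. real (s + j) \<le> y} = {}" by auto
      then show ?thesis by simp
    qed
    then show "emeasure (map_pmf (\<lambda>j. s + j) q) {j. real j \<le> y}
        \<le> emeasure q {j. real j \<le> y} * indicator {j. real j \<le> y} s"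
      by (simp add: vimage_def)
  qed
  also have "\<dots> = emeasure q {j. real j \<le> y} * emeasure (iid_sum_pmf q k) {j. real j \<le> y}"
    by (simp add: nn_integral_cmult)
  also have "\<dots> \<le> emeasure q {j. real j \<le> y} * emeasure q {j. real j \<le> y} ^ k"
    using Suc by (intro mult_left_mono) auto
  finally show ?case by simp
qed (simp add: indicator_def)

text \<open>If the root has k children, all k subtrees must be small. Writing g for the probability
  at generation n, the case k = 1 contributes p_1 g, and k \<ge> 2 at most g^2, hence at most \<eta>
  g; k = 0 has probability zero.\<close>

lemma gw_pmf_small_step:
  assumes p0: "pmf p 0 = 0"
    and small: "measure_pmf.prob (gw_pmf p n) {j. real j \<le> y} \<le> \<eta>"
  shows "measure_pmf.prob (gw_pmf p (Suc n)) {j. real j \<le> y}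
    \<le> (pmf p 1 + \<eta>) * measure_pmf.prob (gw_pmf p n) {j. real j \<le> y}"
proof -
  let ?g = "measure_pmf.prob (gw_pmf p n) {j. real j \<le> y}"
  have "emeasure (gw_pmf p (Suc n)) {j. real j \<le> y}
      = (\<integral>\<^sup>+k. emeasure (iid_sum_pmf (gw_pmf p n) k) {j. real j \<le> y} \<partial>measure_pmf p)"
    unfolding gw_pmf_Suc_first by (simp add: emeasure_bind_pmf)
  also have "\<dots> \<le> (\<integral>\<^sup>+k. ennreal ?g * (indicator {1} k + ennreal ?g) \<partial>measure_pmf p)"
  proof (intro nn_integral_mono_AE AE_pmfI)
    fix k assume "k \<in> set_pmf p"
    then have k: "k \<noteq> 0" using p0 by (metis pmf_eq_0_set_pmf)
    have "emeasure (iid_sum_pmf (gw_pmf p n) k) {j. real j \<le> y} \<le> ennreal ?g ^ k"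
      using emeasure_iid_sum_pmf_le[of "gw_pmf p n" k y] by (simp add: measure_pmf.emeasure_eq_measure)
    also have "\<dots> \<le> ennreal ?g * (indicator {1} k + ennreal ?g)"
    proof (cases "k = 1")
      case False
      then obtain l where l: "k = Suc (Suc l)" using k by (metis One_nat_def not0_implies_Suc)
      have "?g ^ k \<le> ?g * ?g"
        by (simp add: l mult_left_mono mult_right_le_one_le power_le_one)
      then show ?thesis
        using False by (simp add: ennreal_power ennreal_mult[symmetric] ennreal_leI)
    qed (simp add: distrib_left)
    finally show "emeasure (iid_sum_pmf (gw_pmf p n) k) {j. real j \<le> y}
        \<le> ennreal ?g * (indicator {1} k + ennreal ?g)" .
  qed
  also have "\<dots> = ennreal ?g * (ennreal (pmf p 1) + ennreal ?g)"
    by (simp add: nn_integral_cmult nn_integral_add emeasure_pmf_single)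
  also have "\<dots> = ennreal (?g * (pmf p 1 + ?g))"
    by (simp add: ennreal_mult ennreal_plus)
  also have "\<dots> \<le> ennreal (?g * (pmf p 1 + \<eta>))"
    using small by (intro ennreal_leI mult_left_mono) auto
  finally show ?thesis
    using order.trans[OF measure_nonneg small]
    by (simp add: measure_pmf.emeasure_eq_measure mult.commute)
qed

text \<open>The level y stays fixed while generations pass. The probability never rises above
  \<eta>, so the one-step bound keeps applying.\<close>

lemma gw_pmf_small_iterate:
  assumes p0: "pmf p 0 = 0" and \<eta>: "0 \<le> \<eta>" "pmf p 1 + \<eta> \<le> 1"
    and small: "measure_pmf.prob (gw_pmf p n) {j. real j \<le> y} \<le> \<eta>"
  shows "measure_pmf.prob (gw_pmf p (n + k)) {j. real j \<le> y} \<le> (pmf p 1 + \<eta>) ^ k * \<eta>"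
proof (induction k)
  case (Suc k)
  have "(pmf p 1 + \<eta>) ^ k * \<eta> \<le> 1 * \<eta>"
    using \<eta> by (intro mult_right_mono power_le_one) auto
  then have "measure_pmf.prob (gw_pmf p (n + k)) {j. real j \<le> y} \<le> \<eta>" using Suc by simp
  from gw_pmf_small_step[OF p0 this]
  have "measure_pmf.prob (gw_pmf p (n + Suc k)) {j. real j \<le> y}
      \<le> (pmf p 1 + \<eta>) * measure_pmf.prob (gw_pmf p (n + k)) {j. real j \<le> y}" by simp
  also have "\<dots> \<le> (pmf p 1 + \<eta>) * ((pmf p 1 + \<eta>) ^ k * \<eta>)"
    using Suc \<eta> by (intro mult_left_mono) auto
  finally show ?case by simp
qed (use small in simp)

lemma gw_pmf_negative_moment_bound:
  assumes p0: "pmf p 0 = 0" and m: "1 < m" and a: "0 \<le> a"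
    and \<eta>: "0 \<le> \<eta>" "pmf p 1 + \<eta> \<le> 1" "m powr a * (pmf p 1 + \<eta>) < 1"
    and x: "0 < x" "x < 1"
    and tight: "\<And>n. n \<ge> n0 \<Longrightarrow> measure_pmf.prob (gw_pmf p n) {j. real j \<le> x * m ^ n} \<le> \<eta>"
  obtains K where "0 \<le> K"
    "\<And>N. (\<integral>\<^sup>+j. ennreal ((real j / m ^ N) powr (- a)) \<partial>measure_pmf (gw_pmf p N)) \<le> ennreal K"
proof -
  let ?\<rho> = "pmf p 1 + \<eta>"
  \<comment> \<open>For n0 + k \<le> N, exceeding the level c m^k forces Z_N \<le> x m^(N-k), so
    tightness at generation N - k followed by k contractions applies. For N < n0 + k, the factor
    m^n0 / x makes the level unattainable.\<close>
  define c where "c = m ^ n0 / x"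
  have c: "0 < c" using m x by (simp add: c_def)
  define K where "K = c powr a * (1 + m powr a * 1 / (1 - m powr a * ?\<rho>))"
  have "(\<integral>\<^sup>+j. ennreal ((real j / m ^ N) powr (- a)) \<partial>measure_pmf (gw_pmf p N)) \<le> ennreal K" for N
  proof -
    have "(\<integral>\<^sup>+j. ennreal ((m ^ N / real j) powr a) \<partial>measure_pmf (gw_pmf p N)) \<le> ennreal K"
      unfolding K_def
    proof (rule nn_integral_powr_le_geometric[OF _ _ _ c m a])
      fix k :: nat
      have "measure_pmf.prob (gw_pmf p N) {j. c * m ^ k < m ^ N / real j} \<le> ?\<rho> ^ k"
      proof (cases "n0 + k \<le> N")
        case True
        have "real j \<le> x * m ^ (N - k)" if "c * m ^ k < m ^ N / real j" for j
        proof -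
          \<comment> \<open>At j = 0 the quotient is 0 by convention and lies below every
            level.\<close>
          have "j \<noteq> 0" using that c m by (intro notI) (simp add: mult_less_0_iff)
          then have "m ^ n0 * m ^ k * real j < x * m ^ N"
            using that x by (simp add: c_def field_simps)
          also have "m ^ N = m ^ (N - k) * m ^ k"
            using True by (simp add: power_add[symmetric])
          finally have "m ^ n0 * real j < x * m ^ (N - k)"
            using m by (simp add: mult.assoc mult.left_commute[of _ "m ^ k"] mult.commute[of _ "m ^ k"])
          moreover have "1 * real j \<le> m ^ n0 * real j"
            using m by (intro mult_right_mono) auto
          ultimately show ?thesis by simp
        qed
        then have "measure_pmf.prob (gw_pmf p N) {j. c * m ^ k < m ^ N / real j}
            \<le> measure_pmf.prob (gw_pmf p N) {j. real j \<le> x * m ^ (N - k)}"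
          by (intro measure_pmf.finite_measure_mono) auto
        also have "\<dots> \<le> ?\<rho> ^ k * \<eta>"
          using gw_pmf_small_iterate[OF p0 \<eta>(1,2) tight[of "N - k"], of k] True by simp
        also have "\<dots> \<le> ?\<rho> ^ k * 1"
        proof (intro mult_left_mono)
          show "\<eta> \<le> 1" using \<eta> pmf_nonneg[of p 1] by linarith
        qed (use \<eta> in simp)
        finally show ?thesis by simp
      next
        case False
        have "\<not> c * m ^ k < m ^ N / real j" for j
        proof (cases "j = 0")
          case False
          have "m ^ N / real j \<le> m ^ N" using False m by (simp add: field_simps)
          also have "\<dots> \<le> m ^ (n0 + k)"
            using \<open>\<not> n0 + k \<le> N\<close> m by (intro power_increasing) auto
          also have "\<dots> \<le> m ^ (n0 + k) / x" using x m by (simp add: field_simps)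
          finally show ?thesis by (simp add: c_def power_add)
        qed (use c m in \<open>simp add: mult_less_0_iff\<close>)
        then show ?thesis using \<eta> by simp
      qed
      then show "emeasure (measure_pmf (gw_pmf p N)) {j \<in> space (measure_pmf (gw_pmf p N)). c * m ^ k < m ^ N / real j}
          \<le> ennreal (1 * ?\<rho> ^ k)"
        by (simp add: measure_pmf.emeasure_eq_measure ennreal_leI)
    qed (use m \<eta> in \<open>auto simp: measure_pmf.prob_space_axioms\<close>)
    moreover have "(real j / m ^ N) powr (- a) = (m ^ N / real j) powr a" for j
      by (simp add: powr_minus powr_divide)
    ultimately show ?thesis by simp
  qed
  moreover have "0 \<le> K" using \<eta> by (auto simp: K_def)
  ultimately show thesis using that by blast
qed

section \<open>Conditioning on an independent integer and laws of sums\<close>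

lemma (in prob_space) indep_var_cong_left:
  assumes "indep_var S X T Y" and eq: "\<And>x. x \<in> space M \<Longrightarrow> X x = X' x"
  shows "indep_var S X' T Y"
proof -
  have "X -` A \<inter> space M = X' -` A \<inter> space M" for A using eq by auto
  moreover have "random_variable S X \<longleftrightarrow> random_variable S X'"
    by (rule measurable_cong) (rule eq)
  ultimately show ?thesis using assms(1) by (simp add: indep_var_eq)
qed

text \<open>The law of total probability over the countably many values of N. It is applied with N a
  partial sum and Y the next summand, and with N = Z_n and Y k the total offspring of k
  individuals.\<close>

lemma (in prob_space) emeasure_indep_mixture:
  fixes N :: "'a \<Rightarrow> nat" and Y :: "nat \<Rightarrow> 'a \<Rightarrow> nat"
  assumes N: "N \<in> measurable M (count_space UNIV)"
    and Y: "\<And>k. Y k \<in> measurable M (count_space UNIV)"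
    and indep: "\<And>k. indep_var (count_space UNIV) N (count_space UNIV) (Y k)"
    and law: "\<And>k. distr M (count_space UNIV) (Y k) = measure_pmf (q k)"
  shows "emeasure M {x \<in> space M. Q (N x) (Y (N x) x)} = (\<integral>\<^sup>+x. emeasure (q (N x)) {j. Q (N x) j} \<partial>M)"
proof -
  note [measurable] = N Y
  let ?E = "\<lambda>k. {x \<in> space M. N x = k \<and> Q k (Y k x)}"
  have E: "emeasure M (?E k) = emeasure (q k) {j. Q k j} * emeasure M {x \<in> space M. N x = k}" for k
  proof -
    have "prob ((\<lambda>x. (N x, Y k x)) -` ({k} \<times> {j. Q k j}) \<inter> space M)
        = prob (N -` {k} \<inter> space M) * prob (Y k -` {j. Q k j} \<inter> space M)"
      by (rule indep_varD[OF indep]) auto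
    moreover have "(\<lambda>x. (N x, Y k x)) -` ({k} \<times> {j. Q k j}) \<inter> space M = ?E k" by auto
    moreover have "N -` {k} \<inter> space M = {x \<in> space M. N x = k}" by auto
    moreover have "prob (Y k -` {j. Q k j} \<inter> space M) = measure_pmf.prob (q k) {j. Q k j}"
      unfolding law[of k, symmetric] by (rule measure_distr[symmetric]) auto
    ultimately show ?thesis
      by (simp add: emeasure_eq_measure measure_pmf.emeasure_eq_measure ennreal_mult mult.commute)
  qed
  have "{x \<in> space M. Q (N x) (Y (N x) x)} = (\<Union>k. ?E k)" by auto
  also have "emeasure M \<dots> = (\<Sum>k. emeasure M (?E k))"
    by (intro suminf_emeasure[symmetric]) (auto simp: disjoint_family_on_def)
  also have "\<dots> = (\<Sum>k. \<integral>\<^sup>+x. emeasure (q k) {j. Q k j} * indicator {x \<in> space M. N x = k} x \<partial>M)"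
    unfolding E by (intro suminf_cong nn_integral_cmult_indicator[symmetric]) auto
  also have "\<dots> = (\<integral>\<^sup>+x. (\<Sum>k. emeasure (q k) {j. Q k j} * indicator {x \<in> space M. N x = k} x) \<partial>M)"
    by (intro nn_integral_suminf[symmetric]) auto
  also have "\<dots> = (\<integral>\<^sup>+x. emeasure (q (N x)) {j. Q (N x) j} \<partial>M)"
  proof (intro nn_integral_cong)
    fix x assume x: "x \<in> space M"
    have "(\<Sum>k. emeasure (q k) {j. Q k j} * indicator {x \<in> space M. N x = k} x)
        = (\<Sum>k\<in>{N x}. emeasure (q k) {j. Q k j} * indicator {x \<in> space M. N x = k} x)"
      by (intro suminf_finite) auto
    then show "(\<Sum>k. emeasure (q k) {j. Q k j} * indicator {x \<in> space M. N x = k} x)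
        = emeasure (q (N x)) {j. Q (N x) j}" using x by simp
  qed
  finally show ?thesis .
qed

context iid_nat
begin

lemma indep_var_sum_next:
  "indep_var (count_space UNIV) (\<lambda>x. \<Sum>i<k. X i x) (count_space UNIV) (X k)"
proof -
  have 1: "(\<lambda>\<omega>. \<Sum>i<k. \<omega> i) \<in> measurable (PiM {..<k} (\<lambda>_. count_space UNIV)) (count_space (UNIV :: nat set))"
    by measurable
  have 2: "(\<lambda>\<omega>. \<omega> k) \<in> measurable (PiM {k} (\<lambda>_. count_space UNIV)) (count_space (UNIV :: nat set))"
    by measurable
  have "indep_var (PiM {..<k} (\<lambda>_. count_space UNIV)) (\<lambda>\<omega>. restrict (\<lambda>i. X i \<omega>) {..<k})
      (PiM {k} (\<lambda>_. count_space UNIV)) (\<lambda>\<omega>. restrict (\<lambda>i. X i \<omega>) {k})"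
    by (rule indep_var_restrict[OF indep]) auto
  from indep_var_compose[OF this 1 2] show ?thesis by (simp add: comp_def)
qed

lemma distr_sum: "distr M (count_space UNIV) (\<lambda>x. \<Sum>i<k. X i x) = measure_pmf (iid_sum_pmf p k)"
proof (induction k)
  case 0
  show ?case
    by (intro measure_eqI) (auto simp: emeasure_distr indicator_def emeasure_space_1)
next
  case (Suc k)
  let ?S = "\<lambda>x. \<Sum>i<k. X i x"
  show ?case
  proof (rule measure_eqI)
    fix A assume "A \<in> sets (distr M (count_space UNIV) (\<lambda>x. \<Sum>i<Suc k. X i x))"
    have "emeasure (distr M (count_space UNIV) (\<lambda>x. \<Sum>i<Suc k. X i x)) A
        = emeasure M {x \<in> space M. ?S x + X k x \<in> A}"
      by (subst emeasure_distr) (auto intro!: arg_cong[where f = "emeasure M"])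
    also have "\<dots> = (\<integral>\<^sup>+x. emeasure p {j. ?S x + j \<in> A} \<partial>M)"
      using emeasure_indep_mixture[of ?S "\<lambda>_. X k" "\<lambda>_. p" "\<lambda>s j. s + j \<in> A"]
      by (simp add: indep_var_sum_next distr)
    also have "\<dots> = (\<integral>\<^sup>+s. emeasure p {j. s + j \<in> A} \<partial>distr M (count_space UNIV) ?S)"
      by (simp add: nn_integral_distr)
    also have "\<dots> = emeasure (iid_sum_pmf p (Suc k)) A"
      unfolding Suc by (simp add: emeasure_bind_pmf vimage_def)
    finally show "emeasure (distr M (count_space UNIV) (\<lambda>x. \<Sum>i<Suc k. X i x)) A
        = emeasure (iid_sum_pmf p (Suc k)) A" .
  qed simp
qed

end

text \<open>The process as a deterministic functional of the offspring array. This exhibits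
  generation n as a function of rows below n only, which is what gives independence from row
  n.\<close>

primrec gw_size :: "nat \<Rightarrow> (nat \<times> nat \<Rightarrow> nat) \<Rightarrow> nat" where
  "gw_size 0 \<omega> = 1"
| "gw_size (Suc n) \<omega> = (\<Sum>i<gw_size n \<omega>. \<omega> (n, i))"

lemma measurable_gw_size:
  "{..<n} \<times> UNIV \<subseteq> I \<Longrightarrow>
    gw_size n \<in> measurable (PiM I (\<lambda>_. count_space UNIV)) (count_space UNIV)"
proof (induction n)
  case 0
  have "gw_size 0 = (\<lambda>_. 1)" by auto
  then show ?case by simp
next
  case (Suc n)
  have sub: "{..<n} \<times> UNIV \<subseteq> I" "\<And>i. (n, i) \<in> I" using Suc.prems by auto
  have "(\<lambda>\<omega>. \<Sum>i<gw_size n \<omega>. \<omega> (n, i))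
      \<in> measurable (PiM I (\<lambda>_. count_space UNIV)) (count_space UNIV)"
  \<comment> \<open>The number of summands is itself random; measurability is checked for each of
    its countably many values.\<close>
  proof (rule measurable_compose_countable[where f = "\<lambda>k \<omega>. \<Sum>i<k. \<omega> (n, i)" and g = "gw_size n"])
    fix k
    show "(\<lambda>\<omega>. \<Sum>i<k. \<omega> (n, i)) \<in> measurable (PiM I (\<lambda>_. count_space UNIV)) (count_space (UNIV :: nat set))"
      by (intro measurable_sum_nat measurable_component_singleton sub(2))
  qed (rule Suc.IH[OF sub(1)])
  then show ?case by simp
qed

lemma gw_size_restrict:
  "{..<n} \<times> UNIV \<subseteq> I \<Longrightarrow> gw_size n (restrict \<omega> I) = gw_size n \<omega>"
proof (induction n)
  case (Suc n)
  then have "{..<n} \<times> UNIV \<subseteq> I" "\<And>i. (n, i) \<in> I" by auto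
  with Suc.IH show ?case by simp
qed simp

locale gw_process = prob_space M for M :: "'a measure" +
  fixes p :: "nat pmf" and Z :: "nat \<Rightarrow> 'a \<Rightarrow> nat" and \<xi> :: "nat \<Rightarrow> nat \<Rightarrow> 'a \<Rightarrow> nat"
  assumes indep: "indep_vars (\<lambda>_. count_space UNIV) (\<lambda>(n, i). \<xi> n i) UNIV"
    and distr_\<xi>: "distr M (count_space UNIV) (\<xi> n i) = measure_pmf p"
    and Z_0: "x \<in> space M \<Longrightarrow> Z 0 x = 1"
    and Z_Suc: "x \<in> space M \<Longrightarrow> Z (Suc n) x = (\<Sum>i<Z n x. \<xi> n i x)"
begin

lemma measurable_\<xi> [measurable]: "\<xi> n i \<in> measurable M (count_space UNIV)"
  using indep by (force simp: indep_vars_def)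

lemma Z_eq_gw_size: "x \<in> space M \<Longrightarrow> Z n x = gw_size n (\<lambda>j. \<xi> (fst j) (snd j) x)"
  by (induction n) (simp_all add: Z_0 Z_Suc)

lemma iid_nat_\<xi>: "iid_nat M (\<xi> n) p"
proof unfold_locales
  \<comment> \<open>Passing from the array to row n is a reindexing. It is obtained by grouping the
    array into the singleton blocks {(n, i)} and reading off the only coordinate.\<close>
  have "indep_vars (\<lambda>_. count_space UNIV) (\<lambda>i x. (\<lambda>\<omega>. \<omega> (n, i)) (restrict (\<lambda>j. \<xi> (fst j) (snd j) x) {(n, i)})) UNIV"
  proof (rule indep_vars_compose2[where M' = "\<lambda>i. PiM {(n, i)} (\<lambda>_. count_space UNIV)"
        and X = "\<lambda>i x. restrict (\<lambda>j. \<xi> (fst j) (snd j) x) {(n, i)}" and Y = "\<lambda>i \<omega>. \<omega> (n, i)"])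
    have "indep_vars (\<lambda>i. PiM {(n, i)} (\<lambda>_. count_space UNIV))
        (\<lambda>i x. restrict (\<lambda>j. (case j of (n, i) \<Rightarrow> \<xi> n i) x) {(n, i)}) UNIV"
      by (rule indep_vars_restrict[OF indep]) (auto simp: disjoint_family_on_def)
    then show "indep_vars (\<lambda>i. PiM {(n, i)} (\<lambda>_. count_space UNIV))
        (\<lambda>i x. restrict (\<lambda>j. \<xi> (fst j) (snd j) x) {(n, i)}) UNIV"
      by (simp add: case_prod_beta)
  qed measurable
  then show "indep_vars (\<lambda>_. count_space UNIV) (\<xi> n) UNIV" by simp
qed (rule distr_\<xi>)

text \<open>The two variables depend on disjoint blocks of the array, the rows below n and row
  n.\<close>

lemma indep_var_Z_offspring:
  "indep_var (count_space UNIV) (Z n) (count_space UNIV) (\<lambda>x. \<Sum>i<k. \<xi> n i x)"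
proof -
  let ?A = "{..<n} \<times> (UNIV :: nat set)" and ?B = "{n} \<times> (UNIV :: nat set)"
  have 1: "gw_size n \<in> measurable (PiM ?A (\<lambda>_. count_space UNIV)) (count_space UNIV)"
    by (rule measurable_gw_size) simp
  have "(\<lambda>\<omega>. \<omega> (n, i)) \<in> measurable (PiM ?B (\<lambda>_. count_space UNIV)) (count_space (UNIV :: nat set))" for i
    by (rule measurable_component_singleton) auto
  then have 2: "(\<lambda>\<omega>. \<Sum>i<k. \<omega> (n, i)) \<in> measurable (PiM ?B (\<lambda>_. count_space UNIV)) (count_space (UNIV :: nat set))"
    by measurable
  have "indep_var (PiM ?A (\<lambda>_. count_space UNIV)) (\<lambda>x. restrict (\<lambda>j. (case j of (n, i) \<Rightarrow> \<xi> n i) x) ?A)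
      (PiM ?B (\<lambda>_. count_space UNIV)) (\<lambda>x. restrict (\<lambda>j. (case j of (n, i) \<Rightarrow> \<xi> n i) x) ?B)"
    by (rule indep_var_restrict[OF indep]) auto
  from indep_var_compose[OF this 1 2]
  have "indep_var (count_space UNIV) (\<lambda>x. gw_size n (\<lambda>j. \<xi> (fst j) (snd j) x))
      (count_space UNIV) (\<lambda>x. \<Sum>i<k. \<xi> n i x)"
    by (simp add: comp_def gw_size_restrict case_prod_beta)
  then show ?thesis
    by (rule indep_var_cong_left) (simp add: Z_eq_gw_size)
qed

lemma measurable_Z [measurable]: "Z n \<in> measurable M (count_space UNIV)"
  using indep_var_rv1[OF indep_var_Z_offspring] .

lemma emeasure_Z_Z_Suc:
  "emeasure M {x \<in> space M. Q (Z n x) (Z (Suc n) x)}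
    = (\<integral>\<^sup>+x. emeasure (iid_sum_pmf p (Z n x)) {j. Q (Z n x) j} \<partial>M)"
proof -
  interpret \<xi>: iid_nat M "\<xi> n" p by (rule iid_nat_\<xi>)
  have "{x \<in> space M. Q (Z n x) (Z (Suc n) x)} = {x \<in> space M. Q (Z n x) (\<Sum>i<Z n x. \<xi> n i x)}"
    by (auto simp: Z_Suc)
  then show ?thesis
    using emeasure_indep_mixture[of "Z n" "\<lambda>k x. \<Sum>i<k. \<xi> n i x" "iid_sum_pmf p" Q]
    by (simp add: indep_var_Z_offspring \<xi>.distr_sum)
qed

lemma distr_Z: "distr M (count_space UNIV) (Z n) = measure_pmf (gw_pmf p n)"
proof (induction n)
  case 0
  have "Z 0 -` A \<inter> space M = (if 1 \<in> A then space M else {})" for A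
    by (auto simp: Z_0)
  then show ?case
    by (intro measure_eqI) (auto simp: emeasure_distr indicator_def emeasure_space_1)
next
  case (Suc n)
  show ?case
  proof (rule measure_eqI)
    fix A assume "A \<in> sets (distr M (count_space UNIV) (Z (Suc n)))"
    have "emeasure (distr M (count_space UNIV) (Z (Suc n))) A = emeasure M {x \<in> space M. Z (Suc n) x \<in> A}"
      by (subst emeasure_distr) (auto intro!: arg_cong[where f = "emeasure M"])
    also have "\<dots> = (\<integral>\<^sup>+x. emeasure (iid_sum_pmf p (Z n x)) {j. j \<in> A} \<partial>M)"
      by (rule emeasure_Z_Z_Suc)
    also have "\<dots> = (\<integral>\<^sup>+k. emeasure (iid_sum_pmf p k) A \<partial>distr M (count_space UNIV) (Z n))"
      by (simp add: nn_integral_distr)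
    also have "\<dots> = emeasure (gw_pmf p (Suc n)) A"
      unfolding Suc by (simp add: emeasure_bind_pmf)
    finally show "emeasure (distr M (count_space UNIV) (Z (Suc n))) A = emeasure (gw_pmf p (Suc n)) A" .
  qed simp
qed

end

section \<open>Large deviations of the Galton-Watson process\<close>

text \<open>In T(cx)/T(x) the slowly varying factors cancel in the limit. Positivity of T far out
  spreads to the whole line because T is antimonotone.\<close>

lemma regularly_varying_tail_of_asymp_equiv:
  assumes anti: "antimono T" and nonneg: "\<And>x. 0 \<le> T x" and le1: "\<And>x. T x \<le> 1"
    and L: "slowly_varying L" and equiv: "T \<sim>[at_top] (\<lambda>x. x powr (- \<beta>) * L x)"
  shows "regularly_varying_tail \<beta> T" "((\<lambda>x. T x / (x powr (- \<beta>) * L x)) \<longlongrightarrow> 1) at_top"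
proof -
  let ?g = "\<lambda>x. x powr (- \<beta>) * L x"
  obtain x0 where x0: "\<And>x. x \<ge> x0 \<Longrightarrow> 0 < L x"
    using L unfolding slowly_varying_def by auto
  have g_pos: "eventually (\<lambda>x. 0 < ?g x) at_top"
    using eventually_ge_at_top[of x0] eventually_gt_at_top[of 0]
    by eventually_elim (use x0 in auto)
  have "((\<lambda>x. if T x = 0 \<and> ?g x = 0 then 1 else T x / ?g x) \<longlongrightarrow> 1) at_top"
    using equiv by (simp add: asymp_equiv_def)
  \<comment> \<open>Asymptotic equivalence counts 0/0 as 1; the comparison function is eventually
    positive, so the plain quotient remains.\<close>
  moreover have "eventually (\<lambda>x. (if T x = 0 \<and> ?g x = 0 then 1 else T x / ?g x) = T x / ?g x) at_top"
    using g_pos by eventually_elim auto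
  ultimately show lim: "((\<lambda>x. T x / ?g x) \<longlongrightarrow> 1) at_top"
    using tendsto_cong by fast
  have "eventually (\<lambda>x. 0 < T x / ?g x) at_top"
    using lim by (rule order_tendstoD) simp
  then have T_pos_ev: "eventually (\<lambda>x. 0 < T x) at_top"
    using g_pos by eventually_elim (simp add: zero_less_divide_iff zero_less_mult_iff)
  have T_pos: "0 < T x" for x
  proof -
    have "eventually (\<lambda>y. 0 < T y \<and> x \<le> y) at_top"
      using T_pos_ev eventually_ge_at_top[of x] by eventually_elim auto
    then obtain y where "0 < T y" "x \<le> y"
      using eventually_happens'[OF trivial_limit_at_top_linorder] by blast
    then show ?thesis using antimonoD[OF anti, of x y] by linarith
  qed
  have "((\<lambda>x. T (c * x) / T x) \<longlongrightarrow> c powr (- \<beta>)) at_top" if c: "0 < c" for c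
  proof -
    have cx: "filterlim (\<lambda>x. c * x) at_top at_top"
      using c by (intro filterlim_tendsto_pos_mult_at_top[OF tendsto_const] filterlim_ident)
    have "((\<lambda>x. L (c * x) / L x) \<longlongrightarrow> 1) at_top"
      using L c unfolding slowly_varying_def by auto
    then have "((\<lambda>x. (T (c * x) / ?g (c * x)) * inverse (T x / ?g x) * (c powr (- \<beta>) * (L (c * x) / L x)))
        \<longlongrightarrow> 1 * inverse 1 * (c powr (- \<beta>) * 1)) at_top"
      by (intro tendsto_mult tendsto_inverse tendsto_const lim filterlim_compose[OF lim cx]) auto
    moreover have "eventually (\<lambda>x. (T (c * x) / ?g (c * x)) * inverse (T x / ?g x) * (c powr (- \<beta>) * (L (c * x) / L x))
        = T (c * x) / T x) at_top"
      using g_pos eventually_compose_filterlim[OF g_pos cx] eventually_gt_at_top[of 0]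
    proof eventually_elim
      case (elim x)
      have cancel: "a / b * inverse (d / e) * (b / e) = a / d" if "b \<noteq> 0" "d \<noteq> 0" "e \<noteq> 0" for a b d e :: real
        using that by (simp add: field_simps)
      have split: "c powr (- \<beta>) * (L (c * x) / L x) = ?g (c * x) / ?g x"
        using elim(3) by (simp add: powr_mult)
      show ?case
        unfolding split by (rule cancel) (use elim T_pos[of x] in auto)
    qed
    ultimately show ?thesis using tendsto_cong by force
  qed
  then show "regularly_varying_tail \<beta> T"
    using anti T_pos le1 by (simp add: regularly_varying_tail_def)
qed

context gw_process
begin

text \<open>The Laplace transform of W at j tends to 0 as W > 0, and bounded convergence carries its
  smallness over to V_n. Where V_n \<le> 1/j, exp(-j V_n) is at least exp(-1), so Markov's
  inequality gives the claim with y = 1/j; taking j > 1 makes y < 1.\<close>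

lemma tightness_at_zero:
  assumes m: "0 < m"
    and lim: "AE x in M. (\<lambda>n. real (Z n x) / m ^ n) \<longlonglongrightarrow> W x"
    and W[measurable]: "W \<in> borel_measurable M" and W_pos: "AE x in M. 0 < W x" and \<eta>: "0 < \<eta>"
  obtains y n0 where "0 < y" "y < 1"
    "\<And>n. n \<ge> n0 \<Longrightarrow> measure_pmf.prob (gw_pmf p n) {j. real j \<le> y * m ^ n} \<le> \<eta>"
proof -
  let ?V = "\<lambda>n x. real (Z n x) / m ^ n"
  have "(\<lambda>j. expectation (\<lambda>x. exp (- real j * W x))) \<longlonglongrightarrow> expectation (\<lambda>x. 0)"
  proof (rule integral_dominated_convergence[where w = "\<lambda>_. 1"])
    show "AE x in M. (\<lambda>j. exp (- real j * W x)) \<longlonglongrightarrow> 0"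
      using W_pos by eventually_elim real_asymp
    show "AE x in M. norm (exp (- real j * W x)) \<le> 1" for j
      using W_pos by eventually_elim simp
  qed auto
  then have "eventually (\<lambda>j. expectation (\<lambda>x. exp (- real j * W x)) < \<eta> * exp (- 1)) sequentially"
    using \<eta> by (intro order_tendstoD) auto
  then have "eventually (\<lambda>j. expectation (\<lambda>x. exp (- real j * W x)) < \<eta> * exp (- 1) \<and> 1 < j) sequentially"
    using eventually_gt_at_top[of 1] by eventually_elim auto
  then obtain j where j: "expectation (\<lambda>x. exp (- real j * W x)) < \<eta> * exp (- 1)" "1 < j"
    using eventually_happens'[OF sequentially_bot] by blast
  have "(\<lambda>n. expectation (\<lambda>x. exp (- real j * ?V n x))) \<longlonglongrightarrow> expectation (\<lambda>x. exp (- real j * W x))"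
  proof (rule integral_dominated_convergence[where w = "\<lambda>_. 1"])
    show "AE x in M. (\<lambda>n. exp (- real j * ?V n x)) \<longlonglongrightarrow> exp (- real j * W x)"
      using lim by eventually_elim (intro tendsto_exp tendsto_mult tendsto_const)
    show "AE x in M. norm (exp (- real j * ?V n x)) \<le> 1" for n
      using m by auto
  qed auto
  then have "eventually (\<lambda>n. expectation (\<lambda>x. exp (- real j * ?V n x)) < \<eta> * exp (- 1)) sequentially"
    using j by (intro order_tendstoD)
  then obtain n0 where n0: "\<And>n. n \<ge> n0 \<Longrightarrow> expectation (\<lambda>x. exp (- real j * ?V n x)) < \<eta> * exp (- 1)"
    by (auto simp: eventually_sequentially)
  have "measure_pmf.prob (gw_pmf p n) {i. real i \<le> 1 / real j * m ^ n} \<le> \<eta>" if n: "n \<ge> n0" for n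
  proof -
    have int: "integrable M (\<lambda>x. exp (- real j * ?V n x))"
      by (rule integrable_const_bound[where B = 1]) (use m in auto)
    let ?A = "{x \<in> space M. real (Z n x) \<le> 1 / real j * m ^ n}"
    have intA: "integrable M (\<lambda>x. exp (- 1) * indicator ?A x :: real)"
      by (rule integrable_const_bound[where B = 1]) (auto simp: indicator_def)
    have "exp (- 1) * prob ?A = expectation (\<lambda>x. exp (- 1) * indicator ?A x)"
      by simp
    also have "\<dots> \<le> expectation (\<lambda>x. exp (- real j * ?V n x))"
    proof (intro integral_mono int intA)
      fix x assume x: "x \<in> space M"
      show "exp (- 1) * indicator ?A x \<le> exp (- real j * ?V n x)"
        using j(2) m by (auto simp: indicator_def field_simps)
    qed
    also have "\<dots> < \<eta> * exp (- 1)" using n0[OF n] .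
    finally have "prob ?A < \<eta>" by (simp add: mult.commute)
    moreover have "prob ?A = measure_pmf.prob (gw_pmf p n) {i. real i \<le> 1 / real j * m ^ n}"
      unfolding distr_Z[symmetric] by (subst measure_distr) (auto intro!: arg_cong[where f = prob])
    ultimately show ?thesis by simp
  qed
  with j(2) show thesis by (intro that[of "1 / real j" n0]) auto
qed

theorem large_deviation:
  assumes p0: "pmf p 0 = 0" and p1: "pmf p 1 = m powr (- \<gamma>)"
    and int: "integrable (measure_pmf p) real" and mean: "m = measure_pmf.expectation p real"
    and m: "1 < m" and T: "regularly_varying_tail \<beta> (pmf_tail p)"
    and \<beta>: "1 < \<beta>" "\<beta> < 2" "\<beta> - 1 < \<gamma>" and \<epsilon>: "0 < \<epsilon>"
    and lim: "AE x in M. (\<lambda>n. real (Z n x) / m ^ n) \<longlonglongrightarrow> W x"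
    and W[measurable]: "W \<in> borel_measurable M" and W_pos: "AE x in M. 0 < W x"
  shows "(\<lambda>n. prob {x \<in> space M. \<epsilon> \<le> real (Z (Suc n) x) / real (Z n x) - m}
        / (m ^ n * pmf_tail p (m ^ n)))
    \<longlonglongrightarrow> expectation (\<lambda>x. W x powr (1 - \<beta>)) * \<epsilon> powr (- \<beta>)"
proof -
  let ?T = "pmf_tail p"
  let ?V = "\<lambda>n x. real (Z n x) / m ^ n"
  have T_pos: "0 < ?T x" for x using regularly_varying_tailD(2)[OF T] .
  interpret \<xi>: iid_nat M "\<xi> 0" p by (rule iid_nat_\<xi>)
  define \<phi> where "\<phi> k = measure_pmf.prob (iid_sum_pmf p k) {j. \<epsilon> \<le> real j / real k - m}" for k
  define g where "g k = \<phi> k / (real k * ?T (real k))" for k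
  have \<phi>_eq: "\<phi> k = prob {x \<in> space M. (m + \<epsilon>) * real k \<le> (\<Sum>i<k. real (\<xi> 0 i x))}" if "0 < k" for k
  proof -
    have "\<phi> k = prob ((\<lambda>x. \<Sum>i<k. \<xi> 0 i x) -` {j. \<epsilon> \<le> real j / real k - m} \<inter> space M)"
      unfolding \<phi>_def \<xi>.distr_sum[symmetric] by (rule measure_distr) auto
    also have "(\<lambda>x. \<Sum>i<k. \<xi> 0 i x) -` {j. \<epsilon> \<le> real j / real k - m} \<inter> space M
        = {x \<in> space M. (m + \<epsilon>) * real k \<le> (\<Sum>i<k. real (\<xi> 0 i x))}"
      using that by (auto simp: field_simps)
    finally show ?thesis .
  qed
  have g_lim: "g \<longlonglongrightarrow> \<epsilon> powr (- \<beta>)"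
  proof -
    have "eventually (\<lambda>k. prob {x \<in> space M. (m + \<epsilon>) * real k \<le> (\<Sum>i<k. real (\<xi> 0 i x))} / (real k * ?T (real k)) = g k) sequentially"
      using eventually_gt_at_top[of 0] by eventually_elim (simp add: g_def \<phi>_eq)
    then show ?thesis
      using \<xi>.large_deviation_heavy_tail[OF T \<beta>(1,2) int mean \<epsilon>] tendsto_cong by fast
  qed
  have g_nonneg: "0 \<le> g k" for k
    using less_imp_le[OF T_pos] by (simp add: g_def \<phi>_def)
  obtain G where G: "0 < G" "\<And>k. g k \<le> G"
  proof -
    have "Bseq g" using g_lim by (intro convergent_imp_Bseq convergentI)
    then obtain G where "0 < G" "\<And>k. norm (g k) \<le> G" by (auto elim: BseqE)
    then show ?thesis using that[of G] by (auto simp: abs_le_iff)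
  qed
  \<comment> \<open>At k = 0 both sides vanish: 0/0 is 0, so the event would require \<epsilon>
    \<le> -m.\<close>
  have \<phi>_g: "\<phi> k = g k * (real k * ?T (real k))" for k
  proof (cases "k = 0")
    case True
    then show ?thesis using \<epsilon> m by (simp add: \<phi>_def)
  qed (use T_pos[of "real k"] in \<open>simp add: g_def\<close>)
  \<comment> \<open>This is \<open>\<phi> (Z n x)\<close> divided by m^n T(m^n), split into three
    factors that converge separately: the large-deviation ratio, V_n, and a ratio of tails.\<close>
  define f where "f n x = g (Z n x) * (?V n x * (?T (?V n x * m ^ n) / ?T (m ^ n)))" for n x
  have f_meas[measurable]: "f n \<in> borel_measurable M" for n
    unfolding f_def by (rule measurable_compose[OF measurable_Z[of n]]) simp
  have f_nonneg: "0 \<le> f n x" for n x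
    using g_nonneg less_imp_le[OF T_pos] m by (simp add: f_def)
  have prob_eq: "prob {x \<in> space M. \<epsilon> \<le> real (Z (Suc n) x) / real (Z n x) - m} / (m ^ n * ?T (m ^ n))
      = expectation (f n)" for n
  proof -
    have "ennreal (prob {x \<in> space M. \<epsilon> \<le> real (Z (Suc n) x) / real (Z n x) - m})
        = (\<integral>\<^sup>+x. ennreal (\<phi> (Z n x)) \<partial>M)"
      using emeasure_Z_Z_Suc[of "\<lambda>k j. \<epsilon> \<le> real j / real k - m" n]
      by (simp add: \<phi>_def emeasure_eq_measure measure_pmf.emeasure_eq_measure)
    also have "\<dots> = ennreal (expectation (\<lambda>x. \<phi> (Z n x)))"
    proof (rule nn_integral_eq_integral)
      show "integrable M (\<lambda>x. \<phi> (Z n x))"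
        by (rule integrable_const_bound[where B = 1]) (auto simp: \<phi>_def)
    qed (auto simp: \<phi>_def)
    finally have "prob {x \<in> space M. \<epsilon> \<le> real (Z (Suc n) x) / real (Z n x) - m} = expectation (\<lambda>x. \<phi> (Z n x))"
      by (subst (asm) ennreal_inj) (auto simp: \<phi>_def)
    moreover have "f n = (\<lambda>x. \<phi> (Z n x) / (m ^ n * ?T (m ^ n)))"
      using m by (simp add: fun_eq_iff f_def \<phi>_g)
    ultimately show ?thesis by simp
  qed
  have f_lim: "AE x in M. (\<lambda>n. f n x) \<longlonglongrightarrow> \<epsilon> powr (- \<beta>) * W x powr (1 - \<beta>)"
    using lim W_pos
  proof eventually_elim
    case (elim x)
    have mn: "filterlim (\<lambda>n. m ^ n) at_top sequentially"
      using m by real_asymp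
    have "filterlim (\<lambda>n. ?V n x * m ^ n) at_top sequentially"
      using elim mn by (intro filterlim_tendsto_pos_mult_at_top)
    then have "filterlim (\<lambda>n. real (Z n x)) at_top sequentially" using m by simp
    then have "filterlim (\<lambda>n. Z n x) at_top sequentially"
      by (simp add: filterlim_sequentially_iff_filterlim_real)
    then have "(\<lambda>n. g (Z n x)) \<longlonglongrightarrow> \<epsilon> powr (- \<beta>)"
      by (rule filterlim_compose[OF g_lim])
    moreover have "(\<lambda>n. ?T (?V n x * m ^ n) / ?T (m ^ n)) \<longlonglongrightarrow> W x powr (- \<beta>)"
      using regularly_varying_tail_tendsto[OF T mn elim] .
    ultimately have "(\<lambda>n. f n x) \<longlonglongrightarrow> \<epsilon> powr (- \<beta>) * (W x * W x powr (- \<beta>))"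
      unfolding f_def using elim(1) by (intro tendsto_mult)
    moreover have "W x * W x powr (- \<beta>) = W x powr (1 - \<beta>)"
      using elim(2) by (simp add: powr_mult_base)
    ultimately show ?case by simp
  qed
  \<comment> \<open>h is the midpoint of \<beta> - 1 and \<gamma>, and q is chosen so that q h is
    the midpoint of h and \<gamma>.\<close>
  define h where "h = (\<beta> - 1 + \<gamma>) / 2"
  define q where "q = (h + \<gamma>) / (2 * h)"
  have h: "0 < h" "\<beta> - 1 < h" "h < \<gamma>" using \<beta> by (auto simp: h_def)
  have q: "1 < q" "q * h < \<gamma>" using h by (auto simp: q_def field_simps)
  \<comment> \<open>For V_n \<ge> 1 the exponent 1 < \<beta> bounds V_n times the tail ratio by a
    constant. For V_n < 1 the exponent 1 + h > \<beta> bounds it by a multiple of V_n^(-h).\<close>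
  obtain C1 where C1: "0 < C1"
    "\<And>x y. 1 \<le> x \<Longrightarrow> x \<le> y \<Longrightarrow> ?T y \<le> C1 * (y / x) powr (- 1) * ?T x"
    using potter_upper[OF T, of 1] \<beta> by auto
  obtain C2 where C2: "0 < C2"
    "\<And>x y. 1 \<le> x \<Longrightarrow> x \<le> y \<Longrightarrow> ?T x \<le> C2 * (y / x) powr (1 + h) * ?T y"
    using potter_lower[OF T, of "1 + h"] h by auto
  define D where "D = G * (C1 + C2)"
  have D: "0 < D" using G C1 C2 by (simp add: D_def)
  have f_bound: "f n x powr q \<le> D powr q * (1 + ?V n x powr (- (q * h)))" for n x
  proof (cases "Z n x = 0")
    case False
    define v where "v = ?V n x"
    have v: "0 < v" using False m by (simp add: v_def)
    have vm: "v * m ^ n = real (Z n x)" using m by (simp add: v_def)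
    have Z1: "1 \<le> v * m ^ n" using False by (simp add: vm)
    have m1: "1 \<le> m ^ n" using m by simp
    have "f n x \<le> G * (v * (?T (v * m ^ n) / ?T (m ^ n)))"
      unfolding f_def v_def[symmetric] using G less_imp_le[OF T_pos] v
      by (intro mult_right_mono) auto
    moreover have "\<exists>B\<in>{1, v powr (- h)}. v * (?T (v * m ^ n) / ?T (m ^ n)) \<le> (C1 + C2) * B"
    proof (cases "1 \<le> v")
      case True
      then have "?T (v * m ^ n) \<le> C1 * v powr (- 1) * ?T (m ^ n)"
        using C1(2)[of "m ^ n" "v * m ^ n"] m1 m by simp
      then have "v * (?T (v * m ^ n) / ?T (m ^ n)) \<le> C1"
        using v T_pos[of "m ^ n"] by (simp add: powr_minus_divide field_simps)
      then show ?thesis using C2(1) by simp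
    next
      case False
      then have "v * m ^ n \<le> m ^ n" using m v by simp
      from C2(2)[OF Z1 this] have "?T (v * m ^ n) \<le> C2 * (m ^ n / (v * m ^ n)) powr (1 + h) * ?T (m ^ n)" .
      also have "m ^ n / (v * m ^ n) = 1 / v" using m by simp
      also have "(1 / v) powr (1 + h) = v powr (- 1 - h)"
        using v by (simp add: powr_divide powr_minus_divide[symmetric])
      finally have "v * (?T (v * m ^ n) / ?T (m ^ n)) \<le> v * (C2 * v powr (- 1 - h))"
        using v T_pos[of "m ^ n"] by (intro mult_left_mono) (simp_all add: field_simps)
      also have "\<dots> = C2 * (v * v powr (- 1 - h))" by simp
      also have "v * v powr (- 1 - h) = v powr (- h)" using v by (simp add: powr_mult_base)
      also have "C2 * v powr (- h) \<le> (C1 + C2) * v powr (- h)"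
        using C1 by (intro mult_right_mono) auto
      finally show ?thesis by blast
    qed
    ultimately obtain B where B: "B \<in> {1, v powr (- h)}" "f n x \<le> D * B"
      using G(1) unfolding D_def by (smt (verit, ccfv_threshold) mult.assoc mult_left_mono)
    then have "f n x powr q \<le> (D * B) powr q"
      using f_nonneg q by (intro powr_mono2) auto
    also have "\<dots> = D powr q * B powr q" by (rule powr_mult)
    also have "B powr q \<le> 1 + v powr (- (q * h))"
      using B(1) by (auto simp: powr_powr mult.commute)
    finally show ?thesis using D by (simp add: v_def mult_left_mono)
  qed (use D q in \<open>simp add: f_def\<close>)
  \<comment> \<open>The midpoint of p_1 = m^(-\<gamma>) and m^(-qh), so \<eta> = \<rho> - p_1 is
    positive and the geometric series for the moment of order -qh converges.\<close>
  define \<rho> where "\<rho> = (pmf p 1 + m powr (- (q * h))) / 2"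
  have lt: "m powr (- \<gamma>) < m powr (- (q * h))" using m q by simp
  have "m powr (- (q * h)) < 1" using m q h by (simp add: powr_less_one)
  then have \<rho>: "pmf p 1 < \<rho>" "\<rho> < m powr (- (q * h))" "\<rho> \<le> 1"
    using lt unfolding \<rho>_def p1 by (auto simp: field_simps)
  have \<rho>m: "m powr (q * h) * \<rho> < 1"
    using mult_strict_left_mono[OF \<rho>(2), of "m powr (q * h)"] m by (simp add: powr_add[symmetric])
  obtain y n0 where y: "0 < y" "y < 1"
    "\<And>n. n \<ge> n0 \<Longrightarrow> measure_pmf.prob (gw_pmf p n) {j. real j \<le> y * m ^ n} \<le> \<rho> - pmf p 1"
    using tightness_at_zero[OF _ lim W W_pos, of "\<rho> - pmf p 1"] \<rho>(1) m by auto
  obtain K where K: "0 \<le> K"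
    "\<And>n. (\<integral>\<^sup>+j. ennreal ((real j / m ^ n) powr (- (q * h))) \<partial>measure_pmf (gw_pmf p n)) \<le> ennreal K"
    using gw_pmf_negative_moment_bound[OF p0 m, of "q * h" "\<rho> - pmf p 1" y n0] q h \<rho> \<rho>m y by auto
  have moment: "(\<integral>\<^sup>+x. ennreal (f n x powr q) \<partial>M) \<le> ennreal (D powr q * (1 + K))" for n
  proof -
    have "(\<integral>\<^sup>+x. ennreal (f n x powr q) \<partial>M)
        \<le> (\<integral>\<^sup>+x. ennreal (D powr q) * (1 + ennreal (?V n x powr (- (q * h)))) \<partial>M)"
      using f_bound by (intro nn_integral_mono)
        (auto simp: ennreal_mult[symmetric] ennreal_plus[symmetric] ennreal_1[symmetric]
          simp del: ennreal_plus ennreal_1 intro!: ennreal_leI)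
    also have "\<dots> = ennreal (D powr q) * (1 + (\<integral>\<^sup>+x. ennreal (?V n x powr (- (q * h))) \<partial>M))"
      by (simp add: nn_integral_cmult nn_integral_add emeasure_space_1)
    also have "(\<integral>\<^sup>+x. ennreal (?V n x powr (- (q * h))) \<partial>M)
        = (\<integral>\<^sup>+j. ennreal ((real j / m ^ n) powr (- (q * h))) \<partial>measure_pmf (gw_pmf p n))"
      unfolding distr_Z[symmetric] by (simp add: nn_integral_distr)
    also have "ennreal (D powr q) * (1 + \<dots>) \<le> ennreal (D powr q) * (1 + ennreal K)"
      by (intro mult_left_mono add_left_mono K) auto
    also have "\<dots> = ennreal (D powr q * (1 + K))"
      using K(1) by (simp add: ennreal_mult ennreal_plus)
    finally show ?thesis .
  qed
  have "(\<lambda>n. expectation (f n)) \<longlonglongrightarrow> expectation (\<lambda>x. \<epsilon> powr (- \<beta>) * W x powr (1 - \<beta>))"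
    by (rule expectation_tendsto_of_bounded_moment[OF prob_space_axioms f_meas _ _ f_lim q(1) _ moment])
      (use f_nonneg K(1) in auto)
  then show ?thesis by (simp add: prob_eq mult.commute)
qed

end

theorem corollary1p8:
  fixes M :: "'a measure" and p :: "nat pmf" and Z :: "nat \<Rightarrow> 'a \<Rightarrow> nat"
    and W :: "'a \<Rightarrow> real" and w :: "real \<Rightarrow> real"
    and N :: "'b measure" and X :: "nat \<Rightarrow> 'b \<Rightarrow> real" and \<mu> :: "real measure"
    and b s L :: "real \<Rightarrow> real" and m \<gamma> \<beta> \<epsilon> :: real
  assumes GW: "galton_watson M p Z"
    and p0: "pmf p 0 = 0" and p1: "0 < pmf p 1" "pmf p 1 < 1"
    and mean: "integrable (measure_pmf p) real" "m = measure_pmf.expectation p real" "1 < m"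
    and ZlogZ: "integrable M (\<lambda>x. real (Z 1 x) * ln (real (Z 1 x)))"
    and W_lim: "AE x in M. (\<lambda>n. real (Z n x) / m ^ n) \<longlonglongrightarrow> W x"
    and W_density: "continuous_density_on_pos M W w"
    and gamma: "0 < \<gamma>" "pmf p 1 = m powr (- \<gamma>)"
    and X_iid: "iid_copies N X (distr M borel (\<lambda>x. real (Z 1 x) - m))"
    and norming: "norming_function \<beta> b s"
    and stable: "strictly_stable \<beta> \<mu>"
    and attraction: "weak_conv_m (\<lambda>k. distr N borel (\<lambda>y. inverse (b (real k)) * (\<Sum>i<k. X i y))) \<mu>"
    and L: "slowly_varying L"
    and beta: "1 < \<beta>" "\<beta> < 2"
    and tail: "(\<lambda>x. measure M {y \<in> space M. real (Z 1 y) > x}) \<sim>[at_top] (\<lambda>x. x powr (- \<beta>) * L x)"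
    and gamma_beta: "\<beta> - 1 < \<gamma>"
    and eps: "0 < \<epsilon>"
  shows "(\<lambda>n. m powr ((\<beta> - 1) * real n) * inverse (L (m ^ n)) *
            measure M {y \<in> space M. real (Z (Suc n) y) / real (Z n y) - m \<ge> \<epsilon>})
          \<longlonglongrightarrow> moment_I w \<beta> * \<epsilon> powr (- \<beta>)"
proof -
  from GW obtain \<xi> where "gw_process M p Z \<xi>"
    unfolding galton_watson_def gw_process_def gw_process_axioms_def by blast
  then interpret gw_process M p Z \<xi> .
  have tail_eq: "prob {y \<in> space M. x < real (Z 1 y)} = pmf_tail p x" for x
  proof -
    have "gw_pmf p 1 = p"
      using gw_pmf_Suc_first[of p 0] iid_sum_pmf_return_1
      by (simp add: bind_return_pmf' del: gw_pmf.simps(2))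
    moreover have "Z 1 -` {k. x < real k} \<inter> space M = {y \<in> space M. x < real (Z 1 y)}" by auto
    ultimately show ?thesis
      using measure_distr[OF measurable_Z[of 1], of "{k. x < real k}"] by (simp add: distr_Z pmf_tail_def)
  qed
  have "antimono (pmf_tail p)"
    by (auto simp: pmf_tail_def intro!: antimonoI measure_pmf.finite_measure_mono)
  note T = regularly_varying_tail_of_asymp_equiv[OF this _ _ L tail[unfolded tail_eq]]
  have reg: "regularly_varying_tail \<beta> (pmf_tail p)" by (rule T) (auto simp: pmf_tail_def)
  have lim: "((\<lambda>x. pmf_tail p x / (x powr (- \<beta>) * L x)) \<longlongrightarrow> 1) at_top"
    by (rule T) (auto simp: pmf_tail_def)
  have dens: "distributed M lborel W (\<lambda>u. ennreal (indicator {0<..} u * w u))"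
    and w: "\<And>u. 0 < u \<Longrightarrow> 0 \<le> w u"
    using W_density by (auto simp: continuous_density_on_pos_def)
  have W[measurable]: "W \<in> borel_measurable M"
    using distributed_measurable[OF dens] by simp
  \<comment> \<open>The density lives on the positive half-line, so W charges nothing outside
    it.\<close>
  have "AE x in M. 0 < W x"
  proof -
    have "emeasure M (W -` {..0} \<inter> space M) = (\<integral>\<^sup>+u. ennreal (indicator {0<..} u * w u) * indicator {..0} u \<partial>lborel)"
      by (rule distributed_emeasure[OF dens]) simp
    also have "\<dots> = (\<integral>\<^sup>+u. 0 \<partial>(lborel :: real measure))"
      by (intro nn_integral_cong) (auto simp: indicator_def)
    finally show ?thesis
      by (intro AE_I[where N = "W -` {..0} \<inter> space M"]) (auto simp: not_less)
  qed
  from large_deviation[OF p0 gamma(2) mean reg beta gamma_beta eps W_lim W this]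
  have main: "(\<lambda>n. prob {x \<in> space M. \<epsilon> \<le> real (Z (Suc n) x) / real (Z n x) - m} / (m ^ n * pmf_tail p (m ^ n)))
    \<longlonglongrightarrow> expectation (\<lambda>x. W x powr (1 - \<beta>)) * \<epsilon> powr (- \<beta>)" .
  have moment: "expectation (\<lambda>x. W x powr (1 - \<beta>)) = moment_I w \<beta>"
  proof -
    have "expectation (\<lambda>x. W x powr (1 - \<beta>)) = (\<integral>u. (indicator {0<..} u * w u) * u powr (1 - \<beta>) \<partial>lborel)"
      by (rule distributed_integral[OF dens, symmetric]) (use w in \<open>auto simp: indicator_def\<close>)
    also have "\<dots> = moment_I w \<beta>"
      unfolding moment_I_def set_lebesgue_integral_def by (intro Bochner_Integration.integral_cong) auto
    finally show ?thesis .
  qed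
  have mn: "filterlim (\<lambda>n. m ^ n) at_top sequentially" using mean(3) by real_asymp
  \<comment> \<open>Multiplying by a factor tending to 1 replaces T(m^n) in the norming by
    m^(-\<beta>n) L(m^n).\<close>
  from tendsto_mult[OF main filterlim_compose[OF lim mn]]
  have lim2: "(\<lambda>n. prob {x \<in> space M. \<epsilon> \<le> real (Z (Suc n) x) / real (Z n x) - m} / (m ^ n * pmf_tail p (m ^ n))
      * (pmf_tail p (m ^ n) / ((m ^ n) powr (- \<beta>) * L (m ^ n))))
    \<longlonglongrightarrow> moment_I w \<beta> * \<epsilon> powr (- \<beta>)"
    by (simp add: moment)
  have "P / (m ^ n * pmf_tail p (m ^ n)) * (pmf_tail p (m ^ n) / ((m ^ n) powr (- \<beta>) * L (m ^ n)))
      = m powr ((\<beta> - 1) * real n) * inverse (L (m ^ n)) * P" for n P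
  proof -
    have mpow: "m ^ n = m powr real n" using mean(3) by (simp add: powr_realpow)
    have "m powr ((\<beta> - 1) * real n) * (m ^ n * (m ^ n) powr (- \<beta>)) = 1"
      using mean(3) unfolding mpow by (simp add: powr_powr powr_add[symmetric] algebra_simps)
    then have "1 / (m ^ n * (m ^ n) powr (- \<beta>)) = m powr ((\<beta> - 1) * real n)"
      by (metis mult.commute nonzero_eq_divide_eq mult_zero_right zero_neq_one)
    \<comment> \<open>Only t = T(m^n) has to be nonzero. For small n the value L(m^n) might be 0,
      and then both sides are 0.\<close>
    moreover have "P / (m ^ n * t) * (t / (c * l)) = 1 / (m ^ n * c) * inverse l * P" if "t \<noteq> 0" for t c l
      using that by (simp add: divide_inverse)
    ultimately show ?thesis
      using regularly_varying_tailD(2)[OF reg, of "m ^ n"] by (metis less_irrefl)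
  qed
  with lim2 show ?thesis by simp
qed

end
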